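(* Let $A$ be a unital associative $\mathbf{k}$-algebra such that $\mathbf{k}\to A$ is a $\mathbf{k}$-split injection, where $\mathbf{k}$ is a unital commutative $\mathbb{Q}$-algebra. Then there are canonical isomorphisms $$\overline{\mathrm{HH}}_\bullet(A)\ \xrightarrow{\ \sim\ }\ \ker\bigl(\mathsf{i}:\ \overline{\mathrm{DR}}^{\bullet}\to\overline{\Omega}^{\bullet-1}\bigr),$$ $$\overline{\mathrm{HC}}_\bullet(A)\ \xrightarrow{\ \sim\ }\ \ker\bigl(\mathsf{i}:\ \overline{\mathrm{DR}}^{\bullet}/\mathsf{d}\,\overline{\mathrm{DR}}^{\bullet-1}\to\overline{\Omega}^{\bullet-1}/\mathsf{d}\,\overline{\Omega}^{\bullet-2}\bigr).$$ The first isomorphism is induced by the map $\overline{\Omega}\to\overline{\mathrm{DR}}$, $f\mapsto f_\natural$, and the second isomorphism is induced by the map $\overline{\Omega}\otimes R\to\overline{\mathrm{DR}}$, $\sum_{k\ge 0} f_k u^{-k}\mapsto (f_0)_\natural$.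
   Context: $\mathbf{k}$ is a unital commutative $\mathbb{Q}$-algebra, $\otimes=\otimes_{\mathbf{k}}$, $\overline{A}=A/\mathbf{k}$. Noncommutative differential forms: $\Omega=\Omega A$ is the dg algebra generated by $A$ (degree $0$) and symbols $\mathsf{d}a$ (degree $1$), $\mathbf{k}$-linear in $a\in\overline{A}$, with relations: products of elements of $A$ are as in $A$ (same unit), and $\mathsf{d}(ab)=\mathsf{d}a\,b+a\,\mathsf{d}b$; the differential is $a\mapsto \mathsf{d}a\mapsto 0$. One has $A\otimes\overline{A}^{\otimes n}\cong\Omega^nA$ via $a_0\otimes a_1\otimes\cdots\otimes a_n\mapsto a_0\,\mathsf{d}a_1\cdots \mathsf{d}a_n$. All commutators $[\ ,\ ]$ are supercommutators, and $[V,W]$ is the linear span of commutators. Put $\overline{\Omega}=\Omega/\mathbf{k}$ (quotient by $\mathbf{k}\subset\Omega^0$), $\mathrm{DR}=\Omega/[\Omega,\Omega]$, $\overline{\mathrm{DR}}=\mathrm{DR}/\mathbf{k}$; $\mathsf{d}$ descends to all of these. $f_\natural$ denotes the image of $f$ in $\mathrm{DR}$ or $\overline{\mathrm{DR}}$. Operators: the Hochschild differential is $\mathsf{b}(\alpha\,\mathsf{d}a)=(-1)^{n-1}[\alpha,a]$ for $\alpha\in\Omega^{n-1}A$, $a\in A$, and $\mathsf{b}|_{\Omega^0}=0$. The Karoubi operator is $\kappa(\alpha\,\mathsf{d}a)=(-1)^{|\alpha|}\mathsf{d}a\,\alpha$ on forms of degree $\ge1$. The Connes differential is $\mathsf{B}|_{\overline{\Omega}^n}=(\mathrm{Id}+\kappa+\cdots+\kappa^n)\mathsf{d}$.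 The map $$a_0\,\mathsf{d}a_1\cdots\mathsf{d}a_n\mapsto\sum_{\ell=1}^n(-1)^{(\ell-1)(n-1)+1}[a_\ell,\ \mathsf{d}a_{\ell+1}\cdots\mathsf{d}a_n\,a_0\,\mathsf{d}a_1\cdots\mathsf{d}a_{\ell-1}]$$ from $\Omega^n$ to $\Omega^{n-1}$ vanishes on $[\Omega,\Omega]$ and so induces $\mathsf{i}:\mathrm{DR}^\bullet\to\Omega^{\bullet-1}$ and $\mathsf{i}:\overline{\mathrm{DR}}^\bullet\to\overline{\Omega}^{\bullet-1}$; one has $\mathsf{d}\mathsf{i}+\mathsf{i}\mathsf{d}=0$. Let $u$ be a variable of degree $-2$ (so $\overline{\Omega}^p u^{-r}$ has degree $p+2r$), $R=\mathbf{k}(\!(u)\!)/u\mathbf{k}[\![u]\!]$. Reduced Hochschild and cyclic homology (relative to $\mathbf{k}$): $\overline{\mathrm{HH}}_\bullet(A)=H_\bullet(\overline{\Omega},\mathsf{b})$, $\overline{\mathrm{HC}}_\bullet(A)=H_\bullet(\overline{\Omega}\otimes R,\ \mathsf{b}-u\mathsf{B})$. *)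

theory Defs
  imports Complex_Main "HOL-Library.Poly_Mapping" "HOL-Library.Set_Algebras"
begin

section \<open>Base ring and algebras\<close>

definition unital_ring_hom :: "('r::ring_1 \<Rightarrow> 's::ring_1) \<Rightarrow> bool" where
  "unital_ring_hom h \<longleftrightarrow>
     h 1 = 1 \<and> (\<forall>x y. h (x + y) = h x + h y) \<and> (\<forall>x y. h (x * y) = h x * h y)"

definition rational_algebra :: "'k::comm_ring_1 itself \<Rightarrow> bool" where
  "rational_algebra _ \<longleftrightarrow> (\<exists>h :: rat \<Rightarrow> 'k. unital_ring_hom h)"

locale unital_algebra = module scale
  for scale :: "'k::comm_ring_1 \<Rightarrow> 'a::ring_1 \<Rightarrow> 'a" +
  assumes scale_mult_left: "scale c (x * y) = scale c x * y"
    and scale_mult_right: "scale c (x * y) = x * scale c y"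

definition split_unit :: "('k::comm_ring_1 \<Rightarrow> 'a::ring_1 \<Rightarrow> 'a) \<Rightarrow> bool" where
  "split_unit scale \<longleftrightarrow> (\<exists>\<rho>. module_hom scale (*) \<rho> \<and> (\<forall>c. \<rho> (scale c 1) = c))"

section \<open>The free algebra on symbols a and da\<close>

datatype 'a gen = Elt 'a | Diff 'a

datatype 'a word = Word (letters: "'a list")

text \<open>Words form a monoid under concatenation, written additively, so that the convolution
  product on finitely supported functions on words is the free algebra.\<close>

instantiation word :: (type) monoid_add
begin

definition zero_word :: "'a word" where "0 = Word []"

definition plus_word :: "'a word \<Rightarrow> 'a word \<Rightarrow> 'a word" where
  "v + w = Word (letters v @ letters w)"

instance
  by standard (simp_all add: zero_word_def plus_word_def)

end

type_synonym ('a, 'k) free_alg = "'a gen word \<Rightarrow>\<^sub>0 'k"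

definition const_free :: "'k::comm_ring_1 \<Rightarrow> ('a, 'k) free_alg" where
  "const_free c = Poly_Mapping.single 0 c"

definition elt :: "'a \<Rightarrow> ('a, 'k::comm_ring_1) free_alg" where
  "elt a = Poly_Mapping.single (Word [Elt a]) 1"

definition dif :: "'a \<Rightarrow> ('a, 'k::comm_ring_1) free_alg" where
  "dif a = Poly_Mapping.single (Word [Diff a]) 1"

inductive_set two_sided_ideal :: "'r::ring_1 set \<Rightarrow> 'r set" for S where
  base: "x \<in> S \<Longrightarrow> x \<in> two_sided_ideal S"
| zero: "0 \<in> two_sided_ideal S"
| add: "x \<in> two_sided_ideal S \<Longrightarrow> y \<in> two_sided_ideal S \<Longrightarrow> x + y \<in> two_sided_ideal S"
| left: "x \<in> two_sided_ideal S \<Longrightarrow> r * x \<in> two_sided_ideal S"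
| right: "x \<in> two_sided_ideal S \<Longrightarrow> x * r \<in> two_sided_ideal S"

text \<open>The relation \<open>dif 1\<close> together with linearity says that \<open>da\<close> only depends on the class of
  \<open>a\<close> modulo the base ring.\<close>

definition form_relations ::
    "('k::comm_ring_1 \<Rightarrow> 'a::ring_1 \<Rightarrow> 'a) \<Rightarrow> ('a, 'k) free_alg set" where
  "form_relations scale =
     {elt (a + b) - elt a - elt b | a b. True} \<union>
     {elt (scale c a) - const_free c * elt a | c a. True} \<union>
     {elt (a * b) - elt a * elt b | a b. True} \<union>
     {elt 1 - 1} \<union>
     {dif (a + b) - dif a - dif b | a b. True} \<union>
     {dif (scale c a) - const_free c * dif a | c a. True} \<union>
     {dif 1} \<union>
     {dif (a * b) - dif a * elt b - elt a * dif b | a b. True}"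

fun gen_val :: "('a \<Rightarrow> 'w) \<Rightarrow> ('w \<Rightarrow> 'w) \<Rightarrow> 'a gen \<Rightarrow> 'w" where
  "gen_val j d (Elt a) = j a"
| "gen_val j d (Diff a) = d (j a)"

text \<open>The algebra homomorphism from the free algebra sending \<open>a\<close> to \<open>j a\<close> and \<open>da\<close> to
  \<open>d (j a)\<close>.\<close>

definition free_eval ::
    "('k::comm_ring_1 \<Rightarrow> 'w::ring_1 \<Rightarrow> 'w) \<Rightarrow> ('a \<Rightarrow> 'w) \<Rightarrow> ('w \<Rightarrow> 'w) \<Rightarrow> ('a, 'k) free_alg \<Rightarrow> 'w"
  where "free_eval scale j d p =
    (\<Sum>v\<in>Poly_Mapping.keys p. scale (Poly_Mapping.lookup p v)
       (prod_list (map (gen_val j d) (letters v))))"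

fun is_diff :: "'a gen \<Rightarrow> bool" where
  "is_diff (Elt a) = False"
| "is_diff (Diff a) = True"

definition form_degree ::
    "('k::comm_ring_1 \<Rightarrow> 'w::ring_1 \<Rightarrow> 'w) \<Rightarrow> ('a \<Rightarrow> 'w) \<Rightarrow> ('w \<Rightarrow> 'w) \<Rightarrow> nat \<Rightarrow> 'w set" where
  "form_degree scale j d n =
     module.span scale
       {prod_list (map (gen_val j d) gs) | gs. length (filter is_diff gs) = n}"

section \<open>Quotient modules\<close>

text \<open>A pair \<open>(Z, N)\<close> of submodules of an ambient module stands for the image of \<open>Z\<close> in the
  quotient of the ambient module by \<open>N\<close>; its elements are the cosets \<open>x + N\<close> with \<open>x \<in> Z\<close>. Iterated
  quotients are quotients by the preimage in the ambient module. When \<open>N\<close> is a homogeneous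
  submodule and \<open>Z\<close> the degree \<open>n\<close> part of the ambient module, \<open>(Z, N)\<close> is the degree \<open>n\<close> part of
  the graded quotient.\<close>

type_synonym 'v quot = "'v set \<times> 'v set"

definition cosets :: "'v::ab_group_add quot \<Rightarrow> 'v set set" where
  "cosets M = (\<lambda>x. x +o snd M) ` fst M"

text \<open>Sums of cosets are elementwise sums. The multiple of a coset needs the modulus added, since
  multiplication by a noninvertible scalar need not map \<open>N\<close> onto \<open>N\<close>.\<close>

definition coset_scale ::
    "('k \<Rightarrow> 'v::ab_group_add \<Rightarrow> 'v) \<Rightarrow> 'v quot \<Rightarrow> 'k \<Rightarrow> 'v set \<Rightarrow> 'v set" where
  "coset_scale scale M c X = scale c ` X + snd M"

definition quot_iso ::
    "('k \<Rightarrow> 'v::ab_group_add \<Rightarrow> 'v) \<Rightarrow> 'v quot \<Rightarrow> ('k \<Rightarrow> 'w::ab_group_add \<Rightarrow> 'w) \<Rightarrow> 'w quot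
      \<Rightarrow> ('v set \<Rightarrow> 'w set) \<Rightarrow> bool" where
  "quot_iso s M s' M' \<phi> \<longleftrightarrow>
     bij_betw \<phi> (cosets M) (cosets M') \<and>
     (\<forall>X\<in>cosets M. \<forall>Y\<in>cosets M. \<phi> (X + Y) = \<phi> X + \<phi> Y) \<and>
     (\<forall>c. \<forall>X\<in>cosets M. \<phi> (coset_scale s M c X) = coset_scale s' M' c (\<phi> X))"

definition induces_iso ::
    "('v \<Rightarrow> 'w) \<Rightarrow> ('k \<Rightarrow> 'v::ab_group_add \<Rightarrow> 'v) \<Rightarrow> 'v quot
      \<Rightarrow> ('k \<Rightarrow> 'w::ab_group_add \<Rightarrow> 'w) \<Rightarrow> 'w quot \<Rightarrow> bool" where
  "induces_iso f s M s' M' \<longleftrightarrow>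
     (\<exists>\<phi>. (\<forall>x\<in>fst M. \<phi> (x +o snd M) = f x +o snd M') \<and> quot_iso s M s' M' \<phi>)"

text \<open>Kernel of the map from \<open>M\<close> to a quotient by \<open>N'\<close> that is induced by \<open>f\<close>.\<close>

definition quot_kernel :: "('v \<Rightarrow> 'w) \<Rightarrow> 'v quot \<Rightarrow> 'w set \<Rightarrow> 'v quot" where
  "quot_kernel f M N' = ({x \<in> fst M. f x \<in> N'}, snd M)"

text \<open>Homology, at the graded piece \<open>M\<close>, of the quotient of the ambient module by \<open>snd M\<close>, with the
  differential induced by \<open>D\<close>.\<close>

definition homology :: "('v::ab_group_add \<Rightarrow> 'v) \<Rightarrow> 'v quot \<Rightarrow> 'v quot" where
  "homology D M = ({x \<in> fst M. D x \<in> snd M}, range D + snd M)"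

section \<open>Noncommutative differential forms\<close>

text \<open>The dg algebra of noncommutative forms is defined by generators and relations, hence up to
  isomorphism: \<open>'w\<close> with scalar multiplication \<open>sO\<close>, the map \<open>j\<close> from the algebra and the
  differential \<open>d\<close> is any realisation of this presentation.\<close>

locale nc_forms = alg: unital_algebra sA + om: unital_algebra sO
  for sA :: "'k::comm_ring_1 \<Rightarrow> 'a::ring_1 \<Rightarrow> 'a"
    and sO :: "'k \<Rightarrow> 'w::ring_1 \<Rightarrow> 'w" +
  fixes j :: "'a \<Rightarrow> 'w" and d :: "'w \<Rightarrow> 'w"
  assumes d_linear: "module_hom sO sO d"
    and d_d: "d (d x) = 0"
    and d_leibniz: "x \<in> form_degree sO j d p \<Longrightarrow> d (x * y) = d x * y + (-1) ^ p * x * d y"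
    and generated: "surj (free_eval sO j d)"
    and presented: "free_eval sO j d q = 0 \<longleftrightarrow> q \<in> two_sided_ideal (form_relations sA)"
begin

abbreviation Omega :: "nat \<Rightarrow> 'w set" where
  "Omega \<equiv> form_degree sO j d"

abbreviation dword :: "'a list \<Rightarrow> 'w" where
  "dword as \<equiv> prod_list (map (\<lambda>a. d (j a)) as)"

definition scalars :: "'w set" where
  "scalars = range (\<lambda>c. sO c 1)"

definition scomm :: "nat \<Rightarrow> nat \<Rightarrow> 'w \<Rightarrow> 'w \<Rightarrow> 'w" where
  "scomm p q x y = x * y - (-1) ^ (p * q) * (y * x)"

definition commutators :: "'w set" where
  "commutators = om.span {scomm p q x y | p q x y. x \<in> Omega p \<and> y \<in> Omega q}"

text \<open>Each operator below is the unique linear endomorphism of the algebra of forms satisfying its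
  defining formula; uniqueness holds since the forms \<open>j a\<^sub>0 * dword as\<close> span, existence since
  \<open>Omega n\<close> is the tensor product of the algebra with \<open>n\<close> copies of its reduction.\<close>

definition hochschild :: "'w \<Rightarrow> 'w" where
  "hochschild = (THE f. module_hom sO sO f \<and> (\<forall>x\<in>Omega 0. f x = 0) \<and>
     (\<forall>m. \<forall>\<alpha>\<in>Omega m. \<forall>a. f (\<alpha> * d (j a)) = (-1) ^ m * scomm m 0 \<alpha> (j a)))"

text \<open>The Karoubi operator is only used in positive degrees; it is set to zero in degree zero.\<close>

definition karoubi :: "'w \<Rightarrow> 'w" where
  "karoubi = (THE f. module_hom sO sO f \<and> (\<forall>x\<in>Omega 0. f x = 0) \<and>
     (\<forall>m. \<forall>\<alpha>\<in>Omega m. \<forall>a. f (\<alpha> * d (j a)) = (-1) ^ m * (d (j a) * \<alpha>)))"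

definition connes :: "'w \<Rightarrow> 'w" where
  "connes = (THE f. module_hom sO sO f \<and>
     (\<forall>n. \<forall>x\<in>Omega n. f x = (\<Sum>i\<le>n. (karoubi ^^ i) (d x))))"

definition contraction :: "'w \<Rightarrow> 'w" where
  "contraction = (THE f. module_hom sO sO f \<and>
     (\<forall>a0 as. f (j a0 * dword as) =
        (\<Sum>l = 1..length as. (-1) ^ ((l - 1) * (length as - 1) + 1) *
           scomm 0 (length as - 1) (j (as ! (l - 1)))
             (dword (drop l as) * j a0 * dword (take (l - 1) as)))))"

definition Omega_red :: "nat \<Rightarrow> 'w quot" where
  "Omega_red n = (Omega n, scalars)"

definition DR_red :: "nat \<Rightarrow> 'w quot" where
  "DR_red n = (Omega n, commutators + scalars)"

definition Omega_red_mod_d :: "nat \<Rightarrow> 'w quot" where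
  "Omega_red_mod_d n = (Omega n, scalars + range d)"

definition DR_red_mod_d :: "nat \<Rightarrow> 'w quot" where
  "DR_red_mod_d n = (Omega n, commutators + scalars + range d)"

definition HH_red :: "nat \<Rightarrow> 'w quot" where
  "HH_red n = homology hochschild (Omega_red n)"

text \<open>The module \<open>R = k((u))/uk[[u]]\<close> is free on the \<open>u\<^sup>-\<^sup>r\<close>, \<open>r \<ge> 0\<close>. So forms with
  coefficients in \<open>R\<close> are finitely supported sequences \<open>f\<close>, read as the sum of the
  \<open>lookup f r u\<^sup>-\<^sup>r\<close>; multiplication by \<open>u\<close> shifts and kills the term \<open>r = 0\<close>.\<close>

definition u_mult :: "(nat \<Rightarrow>\<^sub>0 'w) \<Rightarrow> (nat \<Rightarrow>\<^sub>0 'w)" where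
  "u_mult f = Abs_poly_mapping (\<lambda>r. Poly_Mapping.lookup f (Suc r))"

definition cyclic_diff :: "(nat \<Rightarrow>\<^sub>0 'w) \<Rightarrow> (nat \<Rightarrow>\<^sub>0 'w)" where
  "cyclic_diff f = Poly_Mapping.map hochschild f - u_mult (Poly_Mapping.map connes f)"

definition cyclic_scale :: "'k \<Rightarrow> (nat \<Rightarrow>\<^sub>0 'w) \<Rightarrow> (nat \<Rightarrow>\<^sub>0 'w)" where
  "cyclic_scale c = Poly_Mapping.map (sO c)"

definition cyclic_red :: "nat \<Rightarrow> (nat \<Rightarrow>\<^sub>0 'w) quot" where
  "cyclic_red n =
     ({f. \<forall>r. if 2 * r \<le> n then Poly_Mapping.lookup f r \<in> Omega (n - 2 * r)
                 else Poly_Mapping.lookup f r = 0},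
      {f. \<forall>r. Poly_Mapping.lookup f r \<in> scalars})"

definition HC_red :: "nat \<Rightarrow> (nat \<Rightarrow>\<^sub>0 'w) quot" where
  "HC_red n = homology cyclic_diff (cyclic_red n)"

text \<open>The contraction lowers the degree by one and vanishes in degree zero. The kernel involves its
  target only through the modulus, which is the same in all degrees; so truncation of
  \<open>n - 1\<close> at \<open>n = 0\<close> is harmless.\<close>

definition ker_DR :: "nat \<Rightarrow> 'w quot" where
  "ker_DR n = quot_kernel contraction (DR_red n) (snd (Omega_red (n - 1)))"

definition ker_DR_mod_d :: "nat \<Rightarrow> 'w quot" where
  "ker_DR_mod_d n = quot_kernel contraction (DR_red_mod_d n) (snd (Omega_red_mod_d (n - 1)))"

end

end

theory Submission
  imports Defs
begin

text \<open>Write \<open>b\<close>, \<open>B\<close>, \<open>\<kappa>\<close>, \<open>i\<close> for the Hochschild, Connes, Karoubi and contraction operators and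
  \<open>N = 1 + \<kappa> + \<dots> + \<kappa>\<^sup>n\<^sup>-\<^sup>1\<close> on forms of degree \<open>n\<close>. On all forms, \<open>1 - \<kappa> = bd + db\<close>,
  \<open>bB + Bb = 0\<close> and \<open>i = bN\<close>, and the commutators are the forms \<open>bx + dby\<close>.

  Surjectivity onto the kernel of \<open>i\<close>: \<open>Ny/n\<close> is congruent to \<open>y\<close> modulo commutators, and
  \<open>b(Ny/n) = iy/n\<close>. Injectivity: if \<open>dbx\<close> is a \<open>b\<close>-cycle then \<open>\<kappa>\<close> fixes it, so that
  \<open>n dbx = Bbx = -bBx\<close>.

  In the cyclic case the same averaging reduces surjectivity to extending \<open>y\<close> with \<open>dby = 0\<close> to a
  cycle \<open>y + f\<^sub>1u\<^sup>-\<^sup>1 + \<dots>\<close>; exactness of \<open>d\<close>, which is where the splitting enters, gives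
  \<open>f\<^sub>1\<close> with \<open>Bf\<^sub>1 = by\<close>, and averaging \<open>f\<^sub>1\<close> achieves \<open>dbf\<^sub>1 = 0\<close>. For injectivity a cycle with
  \<open>f\<^sub>0 = bx + dy\<close> has \<open>dy\<close> fixed by \<open>\<kappa>\<close>, hence in the image of \<open>B\<close>; subtracting a boundary kills
  \<open>f\<^sub>0\<close> and leaves \<open>f\<^sub>1\<close> in the kernel of \<open>B\<close>, so that \<open>f\<^sub>1\<close> has the same shape with \<open>x\<close> exact, and
  \<open>Bd = 0\<close> keeps the next correction from disturbing \<open>f\<^sub>0\<close>.

  No bases are available, so linear maps out of the algebra of forms are built from its presentation:
  the free algebra acts from the right on the functions of \<open>a\<^sub>0, a\<^sub>1, \<dots>, a\<^sub>n\<close> that are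
  multilinear and vanish when some later argument is \<open>1\<close>, and the relations act by zero.\<close>

section \<open>Linear maps out of the algebra of forms\<close>

lemma poly_mapping_add_induct [case_names single add]:
  fixes p :: "'i \<Rightarrow>\<^sub>0 'k::comm_monoid_add"
  assumes single: "\<And>v c. P (Poly_Mapping.single v c)"
    and add: "\<And>p q. P p \<Longrightarrow> P q \<Longrightarrow> P (p + q)"
  shows "P p"
proof (induction p rule: update_induct)
  case const
  show ?case using single[of undefined 0] by simp
next
  case (update f v c)
  then have "Poly_Mapping.update v c f = f + Poly_Mapping.single v c"
    by (intro poly_mapping_eqI)
      (auto simp: lookup_update lookup_add lookup_single when_def in_keys_iff)
  then show ?case using update add single by simp
qed

definition lin_ext ::
    "('k::comm_ring_1 \<Rightarrow> 'v::ab_group_add \<Rightarrow> 'v) \<Rightarrow> ('i \<Rightarrow> 'v) \<Rightarrow> ('i \<Rightarrow>\<^sub>0 'k) \<Rightarrow> 'v" where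
  "lin_ext s g p = (\<Sum>v\<in>Poly_Mapping.keys p. s (Poly_Mapping.lookup p v) (g v))"

context module
begin

lemma lin_ext_superset:
  fixes p :: "'i \<Rightarrow>\<^sub>0 'a"
  assumes "finite S" "Poly_Mapping.keys p \<subseteq> S"
  shows "lin_ext scale g p = (\<Sum>v\<in>S. Poly_Mapping.lookup p v *s g v)"
  unfolding lin_ext_def
  by (rule sum.mono_neutral_left) (use assms in \<open>auto simp: in_keys_iff\<close>)

lemma lin_ext_add:
  fixes p :: "'i \<Rightarrow>\<^sub>0 'a"
  shows "lin_ext scale g (p + q) = lin_ext scale g p + lin_ext scale g q"
proof -
  let ?S = "Poly_Mapping.keys p \<union> Poly_Mapping.keys q"
  have "Poly_Mapping.keys (p + q) \<subseteq> ?S" by (rule keys_add)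
  then show ?thesis
    by (simp add: lin_ext_superset[of ?S] lookup_add scale_left_distrib sum.distrib)
qed

lemma lin_ext_diff:
  fixes p :: "'i \<Rightarrow>\<^sub>0 'a"
  shows "lin_ext scale g (p - q) = lin_ext scale g p - lin_ext scale g q"
  using lin_ext_add[of g "p - q" q] by (simp add: algebra_simps)

lemma lin_ext_single: "lin_ext scale g (Poly_Mapping.single v c) = c *s g v"
  by (simp add: lin_ext_def)

lemma lin_ext_scale: "lin_ext scale g (Poly_Mapping.single 0 c * p) = c *s lin_ext scale g p"
  for p :: "'i::monoid_add \<Rightarrow>\<^sub>0 'a"
  by (induction p rule: poly_mapping_add_induct)
    (simp_all add: distrib_left lin_ext_add scale_right_distrib mult_single lin_ext_single)

end

text \<open>Such an \<open>F\<close> is a linear map on the sum over n of A \<otimes> (A/k)^n, all n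
  being handled at once by letting the later arguments form a list; vanishing at 1 makes each of
  them descend to A/k.\<close>

definition normalized_multilinear ::
    "('k::comm_ring_1 \<Rightarrow> 'a::ring_1 \<Rightarrow> 'a) \<Rightarrow> ('k \<Rightarrow> 'v::ab_group_add \<Rightarrow> 'v)
      \<Rightarrow> ('a \<Rightarrow> 'a list \<Rightarrow> 'v) \<Rightarrow> bool" where
  "normalized_multilinear s t F \<longleftrightarrow>
     (\<forall>as. module_hom s t (\<lambda>a. F a as)) \<and>
     (\<forall>a0 xs ys. module_hom s t (\<lambda>a. F a0 (xs @ a # ys))) \<and>
     (\<forall>a0 xs ys. F a0 (xs @ 1 # ys) = 0)"

text \<open>Precomposition of a function of \<open>a\<^sub>0 da\<^sub>1 \<dots> da\<^sub>n\<close> with left multiplication by a generator,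
  where \<open>da \<cdot> a\<^sub>0 = d(a a\<^sub>0) - a \<cdot> da\<^sub>0\<close>.\<close>

fun gen_act :: "'a::ring_1 gen \<Rightarrow> ('a \<Rightarrow> 'a list \<Rightarrow> 'v::ab_group_add) \<Rightarrow> 'a \<Rightarrow> 'a list \<Rightarrow> 'v" where
  "gen_act (Elt a) F = (\<lambda>a0 as. F (a * a0) as)"
| "gen_act (Diff a) F = (\<lambda>a0 as. F 1 ((a * a0) # as) - F a (a0 # as))"

fun word_act :: "'a::ring_1 gen list \<Rightarrow> ('a \<Rightarrow> 'a list \<Rightarrow> 'v::ab_group_add) \<Rightarrow> 'a \<Rightarrow> 'a list \<Rightarrow> 'v" where
  "word_act [] F = F"
| "word_act (g # gs) F = word_act gs (gen_act g F)"

lemma word_act_append: "word_act (gs @ hs) F = word_act hs (word_act gs F)"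
  by (induction gs arbitrary: F) auto

lemma word_act_add:
  "word_act gs (\<lambda>a as. F a as + G a as) = (\<lambda>a as. word_act gs F a as + word_act gs G a as)"
proof (induction gs arbitrary: F G)
  case (Cons g gs)
  have "gen_act g (\<lambda>a as. F a as + G a as) = (\<lambda>a as. gen_act g F a as + gen_act g G a as)"
    by (cases g) (auto simp: fun_eq_iff)
  then show ?case using Cons by simp
qed simp

lemma normalized_gen_act:
  assumes "unital_algebra s" and F: "normalized_multilinear s t F"
  shows "normalized_multilinear s t (gen_act g F)"
proof -
  interpret unital_algebra s by fact
  have F1: "module_hom s t (\<lambda>a. F a as)" for as
    using F by (simp add: normalized_multilinear_def)
  have F2: "module_hom s t (\<lambda>a. F a0 (xs @ a # ys))" for a0 xs ys
    using F by (simp add: normalized_multilinear_def)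
  have F3: "F a0 (xs @ 1 # ys) = 0" for a0 xs ys
    using F by (simp add: normalized_multilinear_def)
  have t: "module t" using F1 by (simp add: module_hom_iff)
  interpret t: module t by (rule t)
  have add1: "F (a + b) as = F a as + F b as" "F (s c a) as = t c (F a as)" for a b c as
    using F1 by (simp_all add: module_hom_iff)
  have add2: "F a0 (xs @ (a + b) # ys) = F a0 (xs @ a # ys) + F a0 (xs @ b # ys)"
    "F a0 (xs @ s c a # ys) = t c (F a0 (xs @ a # ys))" for a b c a0 xs ys
    using F2 by (simp_all add: module_hom_iff)
  note add20 = add2[where xs = "[]", simplified] and add21 = add2[where xs = "x # xs" for x xs, simplified]
  have F31: "F a0 (x # xs @ 1 # ys) = 0" for a0 x xs ys
    using F3[of a0 "x # xs"] by simp
  show ?thesis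
  proof (cases g)
    case (Elt a)
    then show ?thesis
      by (simp add: normalized_multilinear_def module_hom_iff t module_axioms F3 add2
          distrib_left add1 scale_mult_right[symmetric])
  next
    case (Diff a)
    then show ?thesis
      by (simp add: normalized_multilinear_def module_hom_iff t module_axioms F31 add21 add20
          distrib_left add1 scale_mult_right[symmetric] algebra_simps)
  qed
qed

lemma normalized_word_act:
  assumes "unital_algebra s" "normalized_multilinear s t F"
  shows "normalized_multilinear s t (word_act gs F)"
  using assms(2) by (induction gs arbitrary: F) (auto intro: normalized_gen_act[OF assms(1)])

text \<open>With leading argument 1, \<open>Diff x\<close> turns a function G into
  \<open>G 1 (x # bs) - G x (1 # bs)\<close>, and normalization kills the second term.\<close>

lemma word_act_Diff:
  assumes "unital_algebra s" "normalized_multilinear s t F"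
  shows "word_act (map Diff as) F 1 bs = F 1 (as @ bs)"
proof (induction as arbitrary: bs rule: rev_induct)
  case (snoc x as)
  have "word_act (map Diff as) F x ([] @ 1 # bs) = 0"
    using normalized_word_act[OF assms] unfolding normalized_multilinear_def by blast
  then show ?case using snoc by (simp add: word_act_append)
qed simp

section \<open>The right action of the free algebra and its relations\<close>

definition free_act ::
    "('k::comm_ring_1 \<Rightarrow> 'v::ab_group_add \<Rightarrow> 'v) \<Rightarrow> ('a::ring_1, 'k) free_alg
      \<Rightarrow> ('a \<Rightarrow> 'a list \<Rightarrow> 'v) \<Rightarrow> 'a \<Rightarrow> 'a list \<Rightarrow> 'v" where
  "free_act t p F = (\<lambda>a as. lin_ext t (\<lambda>v. word_act (letters v) F a as) p)"

context
  fixes s :: "'k::comm_ring_1 \<Rightarrow> 'a::ring_1 \<Rightarrow> 'a" and t :: "'k \<Rightarrow> 'v::ab_group_add \<Rightarrow> 'v"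
  assumes s: "unital_algebra s" and t: "module t"
begin

interpretation unital_algebra s by (rule s)
interpretation t: module t by (rule t)

lemma word_act_scale:
  "word_act gs (\<lambda>a as. t c (F a as)) = (\<lambda>a as. t c (word_act gs F a as))"
proof (induction gs arbitrary: F)
  case (Cons g gs)
  have "gen_act g (\<lambda>a as. t c (F a as)) = (\<lambda>a as. t c (gen_act g F a as))"
    by (cases g) (auto simp: fun_eq_iff t.scale_right_diff_distrib)
  then show ?case using Cons by simp
qed simp

lemma free_act_single:
  "free_act t (Poly_Mapping.single v c) F = (\<lambda>a as. t c (word_act (letters v) F a as))"
  by (simp add: free_act_def t.lin_ext_single)

lemma free_act_add:
  "free_act t (p + q) F = (\<lambda>a as. free_act t p F a as + free_act t q F a as)"
  by (simp add: free_act_def t.lin_ext_add)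

lemma free_act_add_right:
  "free_act t p (\<lambda>a as. F a as + G a as) = (\<lambda>a as. free_act t p F a as + free_act t p G a as)"
  by (induction p rule: poly_mapping_add_induct)
    (simp_all add: free_act_single free_act_add word_act_add t.scale_right_distrib algebra_simps)

lemma free_act_mult: "free_act t (p * q) F = free_act t q (free_act t p F)"
proof (induction p arbitrary: F rule: poly_mapping_add_induct)
  case (single v c)
  show ?case
    by (induction q rule: poly_mapping_add_induct)
      (simp_all add: distrib_left free_act_add free_act_single mult_single plus_word_def
        word_act_append word_act_scale mult.commute)
next
  case (add p q')
  then show ?case by (simp add: distrib_right free_act_add free_act_add_right)
qed

lemma free_act_normalized:
  assumes "normalized_multilinear s t F"
  shows "normalized_multilinear s t (free_act t p F)"
proof (induction p rule: poly_mapping_add_induct)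
  case (single v c)
  show ?case using normalized_word_act[OF s assms, of "letters v"]
    by (simp add: normalized_multilinear_def free_act_single module_hom_iff t.scale_right_distrib
        mult.commute)
next
  case (add p q)
  then show ?case
    by (simp add: normalized_multilinear_def free_act_add module_hom_iff t.scale_right_distrib
        algebra_simps)
qed

text \<open>Only the relations need computation. A left multiple \<open>r * x\<close> makes
  \<open>x\<close> act on another normalized function, hence the induction over all
  \<open>F\<close>; a right multiple makes \<open>r\<close> act on zero.\<close>

lemma free_act_ideal:
  assumes "x \<in> two_sided_ideal (form_relations s)" "normalized_multilinear s t F"
  shows "free_act t x F = (\<lambda>a as. 0)"
  using assms
proof (induction arbitrary: F)
  case (base x)
  have F1: "module_hom s t (\<lambda>a. F a as)" for as
    using base by (simp add: normalized_multilinear_def)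
  have F2: "module_hom s t (\<lambda>a. F a0 ([] @ a # ys))" for a0 ys
    using base unfolding normalized_multilinear_def by blast
  note lin = F1[THEN module_hom.add] F1[THEN module_hom.scale] F1[THEN module_hom.diff]
    F2[THEN module_hom.add, simplified] F2[THEN module_hom.scale, simplified]
    F2[THEN module_hom.diff, simplified]
  have diff: "free_act t (p - q) F = (\<lambda>a as. free_act t p F a as - free_act t q F a as)" for p q
    by (simp add: free_act_def t.lin_ext_diff)
  have one: "(1 :: ('a, 'k) free_alg) = Poly_Mapping.single (Word []) 1"
    by (metis single_one zero_word_def)
  have scale: "free_act t (const_free c * q) F = (\<lambda>a as. t c (free_act t q F a as))" for c q
    by (simp add: free_act_def const_free_def t.lin_ext_scale)
  show ?case
    using base(1) unfolding form_relations_def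
    by (elim UnE CollectE exE conjE insertE emptyE)
      (simp_all add: diff one scale elt_def dif_def free_act_single mult_single plus_word_def
        lin distrib_right scale_mult_left[symmetric] mult.assoc
        t.scale_right_diff_distrib fun_eq_iff)
next
  case zero
  show ?case by (simp add: free_act_def lin_ext_def)
next
  case (add x y)
  then show ?case by (simp add: free_act_add)
next
  case (left x r)
  then show ?case by (simp add: free_act_mult free_act_normalized)
next
  case (right x r)
  then have "free_act t (x * r) F = free_act t r (\<lambda>a as. 0)" by (simp add: free_act_mult)
  also have "\<dots> = (\<lambda>a as. 0)"
    using free_act_add_right[of r "\<lambda>a as. 0" "\<lambda>a as. 0"] by (simp add: fun_eq_iff)
  finally show ?case .
qed

end

section \<open>Evaluation of the free algebra and the universal property of forms\<close>

context nc_forms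
begin

lemma free_eval_eq: "free_eval sO j d = lin_ext sO (\<lambda>v. prod_list (map (gen_val j d) (letters v)))"
  by (simp add: fun_eq_iff free_eval_def lin_ext_def)

lemma free_eval_add: "free_eval sO j d (p + q) = free_eval sO j d p + free_eval sO j d q"
  by (simp add: free_eval_eq om.lin_ext_add)

lemma free_eval_diff: "free_eval sO j d (p - q) = free_eval sO j d p - free_eval sO j d q"
  by (simp add: free_eval_eq om.lin_ext_diff)

lemma free_eval_single:
  "free_eval sO j d (Poly_Mapping.single v c) = sO c (prod_list (map (gen_val j d) (letters v)))"
  by (simp add: free_eval_eq om.lin_ext_single)

lemma free_eval_scale:
  "free_eval sO j d (const_free c * q) = sO c (free_eval sO j d q)"
  by (simp add: free_eval_eq const_free_def om.lin_ext_scale)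

lemma free_eval_mult: "free_eval sO j d (p * q) = free_eval sO j d p * free_eval sO j d q"
proof (induction p rule: poly_mapping_add_induct)
  case (single v c)
  show ?case
    by (induction q rule: poly_mapping_add_induct)
      (simp_all add: distrib_left free_eval_add free_eval_single mult_single plus_word_def
        om.scale_mult_left[symmetric] om.scale_mult_right[symmetric] mult.commute[where 'a = 'k])
next
  case (add p q')
  then show ?case by (simp add: distrib_right free_eval_add)
qed

lemma free_eval_relation: "r \<in> form_relations sA \<Longrightarrow> free_eval sO j d r = 0"
  by (simp add: presented two_sided_ideal.base)

lemma free_eval_elt: "free_eval sO j d (elt a) = j a"
  by (simp add: elt_def free_eval_single)

lemma j_add: "j (a + b) = j a + j b"
  and j_scale: "j (sA c a) = sO c (j a)"
  and j_mult: "j (a * b) = j a * j b"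
  and j_one: "j 1 = 1"
proof -
  have "free_eval sO j d (elt (a + b) - elt a - elt b) = 0"
    by (rule free_eval_relation) (auto simp: form_relations_def)
  then show "j (a + b) = j a + j b"
    by (simp add: free_eval_diff free_eval_elt diff_diff_eq2 diff_diff_eq free_eval_add)
  have "free_eval sO j d (elt (sA c a) - const_free c * elt a) = 0"
    by (rule free_eval_relation) (auto simp: form_relations_def)
  then show "j (sA c a) = sO c (j a)"
    by (simp add: free_eval_diff free_eval_elt free_eval_scale)
  have "free_eval sO j d (elt (a * b) - elt a * elt b) = 0"
    by (rule free_eval_relation) (auto simp: form_relations_def)
  then show "j (a * b) = j a * j b"
    by (simp add: free_eval_diff free_eval_elt free_eval_mult)
  have "free_eval sO j d (elt 1 - 1) = 0"
    by (rule free_eval_relation) (auto simp: form_relations_def)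
  then show "j 1 = 1"
    by (simp add: free_eval_diff free_eval_elt free_eval_single zero_word_def flip: single_one)
qed

text \<open>This universal property stands in for the isomorphism of the forms with the sum over n
  of A \<otimes> (A/k)^n; it is the source of the operators constructed below.\<close>

lemma linear_map_exists:
  assumes t: "module t" and F: "normalized_multilinear sA t F"
  shows "\<exists>f. module_hom sO t f \<and> (\<forall>a0 as. f (j a0 * dword as) = F a0 as)"
proof -
  interpret t: module t by (rule t)
  note A = alg.unital_algebra_axioms
  \<comment> \<open>A form acts through any preimage in the free algebra, and the resulting function
    is read off at \<open>1\<close> and the empty list. Two preimages differ by an element of the
    ideal, which acts by zero.\<close>
  define f where "f w = free_act t (SOME p. free_eval sO j d p = w) F 1 []" for w
  have f_eval: "f (free_eval sO j d p) = free_act t p F 1 []" for p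
  proof -
    define q where "q = (SOME q. free_eval sO j d q = free_eval sO j d p)"
    have "free_eval sO j d q = free_eval sO j d p"
      unfolding q_def by (rule someI) simp
    then have "q - p \<in> two_sided_ideal (form_relations sA)"
      by (simp add: presented[symmetric] free_eval_diff)
    from free_act_ideal[OF A t this F] have "free_act t ((q - p) + p) F 1 [] = free_act t p F 1 []"
      by (simp only: free_act_add[OF A t]) simp
    then show ?thesis by (simp add: f_def q_def)
  qed
  have "module_hom sO t f"
  proof (unfold module_hom_iff, intro conjI allI)
    fix x y
    obtain p q where pq: "x = free_eval sO j d p" "y = free_eval sO j d q"
      using generated by (metis surjD)
    show "f (x + y) = f x + f y"
      unfolding pq f_eval free_eval_add[symmetric] by (simp add: free_act_add[OF A t])
    show "f (sO c x) = t c (f x)" for c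
      unfolding pq f_eval free_eval_scale[symmetric]
      by (simp add: free_act_def const_free_def t.lin_ext_scale)
  qed (fact om.module_axioms t)+
  moreover have "f (j a0 * dword as) = F a0 as" for a0 as
  proof -
    have "j a0 * dword as =
        free_eval sO j d (Poly_Mapping.single (Word (Elt a0 # map Diff as)) 1)"
      by (simp add: free_eval_single o_def)
    then have "f (j a0 * dword as) = word_act (map Diff as) (gen_act (Elt a0) F) 1 []"
      by (simp add: f_eval free_act_single[OF A t])
    also have "\<dots> = F a0 as"
      using word_act_Diff[OF A normalized_gen_act[OF A F, of "Elt a0"], of as "[]"] by simp
    finally show ?thesis .
  qed
  ultimately show ?thesis by blast
qed

section \<open>The grading\<close>

abbreviation lin :: "('w \<Rightarrow> 'w) \<Rightarrow> bool" where
  "lin \<equiv> module_hom sO sO"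

lemma lin_iff: "lin f \<longleftrightarrow> (\<forall>x y. f (x + y) = f x + f y) \<and> (\<forall>c x. f (sO c x) = sO c (f x))"
  by (simp add: module_hom_iff om.module_axioms)

lemma lin_compose: "lin f \<Longrightarrow> lin g \<Longrightarrow> lin (\<lambda>x. f (g x))"
  and lin_add: "lin f \<Longrightarrow> lin g \<Longrightarrow> lin (\<lambda>x. f x + g x)"
  and lin_diff: "lin f \<Longrightarrow> lin g \<Longrightarrow> lin (\<lambda>x. f x - g x)"
  and lin_id: "lin (\<lambda>x. x)"
  and lin_zero: "lin (\<lambda>x. 0)"
  and lin_mult_left: "lin f \<Longrightarrow> lin (\<lambda>x. w * f x)"
  and lin_mult_right: "lin f \<Longrightarrow> lin (\<lambda>x. f x * w)"
  and lin_scale: "lin f \<Longrightarrow> lin (\<lambda>x. sO c (f x))"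
  by (auto simp: lin_iff algebra_simps om.scale_mult_left[symmetric] om.scale_mult_right[symmetric])

lemma lin_sum: "(\<And>i. i \<in> S \<Longrightarrow> lin (f i)) \<Longrightarrow> lin (\<lambda>x. \<Sum>i\<in>S. f i x)"
  by (auto simp: lin_iff sum.distrib om.scale_sum_right)

lemma lin_funpow: "lin f \<Longrightarrow> lin (f ^^ i)"
  by (induction i) (auto simp: lin_iff)

lemmas lin_intros = lin_add lin_diff lin_id lin_zero lin_mult_left lin_mult_right
  lin_scale lin_sum lin_funpow

lemmas d_add = module_hom.add[OF d_linear]
  and d_scale = module_hom.scale[OF d_linear]
  and d_diff = module_hom.diff[OF d_linear]
  and d_zero = module_hom.zero[OF d_linear]
  and d_neg = module_hom.neg[OF d_linear]

lemma Omega_word: "length (filter is_diff gs) = n \<Longrightarrow> prod_list (map (gen_val j d) gs) \<in> Omega n"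
  unfolding form_degree_def by (rule om.span_base) blast

lemma Omega_subspace: "om.subspace (Omega n)"
  by (simp add: form_degree_def)

lemma Omega_add: "x \<in> Omega n \<Longrightarrow> y \<in> Omega n \<Longrightarrow> x + y \<in> Omega n"
  and Omega_diff: "x \<in> Omega n \<Longrightarrow> y \<in> Omega n \<Longrightarrow> x - y \<in> Omega n"
  and Omega_neg: "x \<in> Omega n \<Longrightarrow> - x \<in> Omega n"
  and Omega_scale: "x \<in> Omega n \<Longrightarrow> sO c x \<in> Omega n"
  and Omega_zero: "0 \<in> Omega n"
  and Omega_sum: "(\<And>i. i \<in> S \<Longrightarrow> g i \<in> Omega n) \<Longrightarrow> sum g S \<in> Omega n"
  by (simp_all add: form_degree_def om.span_add om.span_diff om.span_neg om.span_scale
      om.span_zero om.span_sum)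

lemma Omega_j: "j a \<in> Omega 0" and Omega_dj: "d (j a) \<in> Omega 1"
  using Omega_word[of "[Elt a]"] Omega_word[of "[Diff a]"] by auto

lemma Omega_one: "1 \<in> Omega 0"
  using Omega_word[of "[]"] by simp

lemma Omega_mult:
  assumes "x \<in> Omega m" "y \<in> Omega n"
  shows "x * y \<in> Omega (m + n)"
proof -
  have *: "prod_list (map (gen_val j d) gs) * y \<in> Omega (m + n)"
    if "length (filter is_diff gs) = m" for gs
    using assms(2) unfolding form_degree_def[of _ _ _ n]
  proof (induction rule: om.span_induct_alt)
    case base
    show ?case by (simp add: Omega_zero)
  next
    case (step c u v)
    then obtain hs where "u = prod_list (map (gen_val j d) hs)" "length (filter is_diff hs) = n"
      by auto
    then have "prod_list (map (gen_val j d) gs) * u \<in> Omega (m + n)"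
      using Omega_word[of "gs @ hs" "m + n"] that by simp
    then show ?case using step
      by (simp add: distrib_left om.scale_mult_right[symmetric] Omega_add Omega_scale)
  qed
  show ?thesis
    using assms(1) unfolding form_degree_def[of _ _ _ m]
  proof (induction rule: om.span_induct_alt)
    case base
    show ?case by (simp add: Omega_zero)
  next
    case (step c u v)
    then show ?case using *
      by (auto simp: distrib_right om.scale_mult_left[symmetric] Omega_add Omega_scale)
  qed
qed

lemma Omega_dword: "dword as \<in> Omega (length as)"
  using Omega_word[of "map Diff as" "length as"] by (simp add: o_def)

lemma Omega_basic: "j a * dword as \<in> Omega (length as)"
  using Omega_mult[OF Omega_j Omega_dword] by simp

lemma d_mult: "x \<in> Omega p \<Longrightarrow> d (x * y) = d x * y + (-1) ^ p * x * d y"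
  by (rule d_leibniz)

lemma d_one: "d 1 = 0"
  using d_mult[OF Omega_one, of 1] by simp

lemma d_j_mult: "d (j a * y) = d (j a) * y + j a * d y"
  using d_mult[OF Omega_j] by simp

lemma d_dword: "d (dword as) = 0"
  by (induction as) (simp_all add: d_one d_d d_mult[OF Omega_dj])

lemma d_basic: "d (j a * dword as) = dword (a # as)"
  by (simp add: d_j_mult d_dword)

text \<open>The span on the right is stable under left multiplication by generators: for a product w
  of differentials, da (b w) = d(ab) w - a db w keeps the factors of degree zero in front.\<close>

lemma Omega_eq: "Omega n = om.span {j a * dword as | a as. length as = n}"
proof
  let ?S = "\<lambda>n. om.span {j a * dword as | a as. length as = n}"
  show "?S n \<subseteq> Omega n"
    by (rule om.span_minimal) (auto simp: Omega_basic Omega_subspace)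
  have basic: "j a * dword as \<in> ?S (length as)" for a as
    by (rule om.span_base) blast
  have "prod_list (map (gen_val j d) gs) \<in> ?S (length (filter is_diff gs))" for gs
  proof (induction gs)
    case Nil
    show ?case using basic[of 1 "[]"] by (simp add: j_one)
  next
    case (Cons g gs)
    show ?case
    proof (cases g)
      case (Elt a)
      have "j a * x \<in> ?S m" if "x \<in> ?S m" for x m
        using that
      proof (induction rule: om.span_induct_alt)
        case (step c u v)
        then obtain b bs where u: "u = j b * dword bs" "length bs = m" by auto
        have "j a * u \<in> ?S m" using basic[of "a * b" bs] by (simp add: u j_mult mult.assoc)
        then show ?case using step
          by (simp add: distrib_left om.scale_mult_right[symmetric] om.span_add om.span_scale)
      qed (simp add: om.span_zero)
      then show ?thesis using Cons Elt by simp
    next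
      case (Diff a)
      have "d (j a) * x \<in> ?S (Suc m)" if "x \<in> ?S m" for x m
        using that
      proof (induction rule: om.span_induct_alt)
        case (step c u v)
        then obtain b bs where u: "u = j b * dword bs" "length bs = m" by auto
        have "d (j a) * u = j 1 * dword ((a * b) # bs) - j a * dword (b # bs)"
          by (simp add: u j_mult d_j_mult j_one algebra_simps)
        also have "\<dots> \<in> ?S (Suc m)"
          using basic[of 1 "(a * b) # bs"] basic[of a "b # bs"] u(2) by (auto intro: om.span_diff)
        finally show ?case using step
          by (simp add: distrib_left om.scale_mult_right[symmetric] om.span_add om.span_scale)
      qed (simp add: om.span_zero)
      then show ?thesis using Cons Diff by simp
    qed
  qed
  then show "Omega n \<subseteq> ?S n"
    unfolding form_degree_def by (intro om.span_minimal) auto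
qed

lemma Omega_induct [consumes 1, case_names zero add scale basic]:
  assumes "x \<in> Omega n"
    and "P 0"
    and "\<And>x y. x \<in> Omega n \<Longrightarrow> y \<in> Omega n \<Longrightarrow> P x \<Longrightarrow> P y \<Longrightarrow> P (x + y)"
    and "\<And>c x. x \<in> Omega n \<Longrightarrow> P x \<Longrightarrow> P (sO c x)"
    and "\<And>a as. length as = n \<Longrightarrow> P (j a * dword as)"
  shows "P x"
proof -
  have "x \<in> Omega n \<and> P x"
    using assms(1) unfolding Omega_eq[of n]
  proof (induction rule: om.span_induct_alt)
    case base
    show ?case using assms(2) by (simp add: om.span_zero)
  next
    case (step c u y)
    then obtain a as where u: "u = j a * dword as" "length as = n" by auto
    then have "u \<in> Omega n" "P u" using Omega_basic assms(5) by auto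
    then show ?case
      using step by (auto simp flip: Omega_eq intro!: assms(3,4) Omega_add Omega_scale)
  qed
  then show ?thesis ..
qed

lemma Omega_eqI:
  assumes "lin f" "lin g" "\<And>a as. length as = n \<Longrightarrow> f (j a * dword as) = g (j a * dword as)"
    and "x \<in> Omega n"
  shows "f x = g x"
  using assms(4,3)
  by (induction rule: Omega_induct)
    (simp_all add: module_hom.zero[OF assms(1)] module_hom.zero[OF assms(2)]
      module_hom.add[OF assms(1)] module_hom.add[OF assms(2)]
      module_hom.scale[OF assms(1)] module_hom.scale[OF assms(2)])

text \<open>Every word in the generators is homogeneous, so the \<open>Omega n\<close> together span
  the algebra.\<close>

lemma form_induct [case_names add hom]:
  assumes "\<And>x y. P x \<Longrightarrow> P y \<Longrightarrow> P (x + y)" "\<And>n x. x \<in> Omega n \<Longrightarrow> P x"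
  shows "P x"
proof -
  obtain p where "x = free_eval sO j d p" using generated by (metis surjD)
  moreover have "P (free_eval sO j d p)"
    by (induction p rule: poly_mapping_add_induct)
      (auto simp: free_eval_single free_eval_add intro!: assms(1) intro: assms(2) Omega_scale Omega_word)
  ultimately show ?thesis by simp
qed

lemma form_eqI:
  assumes "lin f" "lin g" "\<And>n x. x \<in> Omega n \<Longrightarrow> f x = g x"
  shows "f x = g x"
  by (induction x rule: form_induct)
    (auto simp: assms module_hom.add[OF assms(1)] module_hom.add[OF assms(2)])

lemma form_eqI_basic:
  assumes "lin f" "lin g" "\<And>a as. f (j a * dword as) = g (j a * dword as)"
  shows "f x = g x"
  by (rule form_eqI[OF assms(1,2)], rule Omega_eqI[OF assms(1,2)]) (simp_all add: assms(3))

lemma d_Omega: "x \<in> Omega n \<Longrightarrow> d x \<in> Omega (Suc n)"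
proof (induction rule: Omega_induct)
  case (basic a as)
  then show ?case using Omega_dword[of "a # as"] by (simp add: d_basic del: list.map)
qed (simp_all add: d_zero d_add d_scale Omega_zero Omega_add Omega_scale)

lemma normalized_basic: "normalized_multilinear sA sO (\<lambda>a as. j a * dword as)"
  by (simp add: normalized_multilinear_def module_hom_iff om.module_axioms alg.module_axioms j_add
      j_scale j_one d_add d_scale d_one algebra_simps om.scale_mult_left[symmetric]
      om.scale_mult_right[symmetric])

lemma normalized_graded:
  assumes "\<And>n. lin (G n)"
  shows "normalized_multilinear sA sO (\<lambda>a as. G (length as) (j a * dword as))"
  using normalized_basic
  by (auto simp: normalized_multilinear_def module_hom_iff om.module_axioms alg.module_axioms
      module_hom.add[OF assms] module_hom.scale[OF assms] module_hom.zero[OF assms])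

text \<open>Unrelated maps \<open>G n\<close> in different degrees are compatible because the list
  of differentials records the degree. Applied to projections, this shows that the sum of the
  \<open>Omega n\<close> is direct.\<close>

lemma graded_map_exists:
  assumes "\<And>n. lin (G n)"
  shows "\<exists>f. lin f \<and> (\<forall>n. \<forall>x\<in>Omega n. f x = G n x)"
proof -
  obtain f where f: "lin f" "\<And>a as. f (j a * dword as) = G (length as) (j a * dword as)"
    using linear_map_exists[OF om.module_axioms normalized_graded[of G, OF assms]] by blast
  then have "f x = G n x" if "x \<in> Omega n" for n x
    by (intro Omega_eqI[OF f(1) assms _ that]) simp
  then show ?thesis using f(1) by blast
qed

section \<open>Projections onto the homogeneous parts\<close>

definition proj :: "nat \<Rightarrow> 'w \<Rightarrow> 'w" where
  "proj n = (SOME f. lin f \<and> (\<forall>m. \<forall>x\<in>Omega m. f x = (if m = n then x else 0)))"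

lemma proj_lin: "lin (proj n)"
  and proj_Omega: "x \<in> Omega m \<Longrightarrow> proj n x = (if m = n then x else 0)"
proof -
  have "\<exists>f. lin f \<and> (\<forall>m. \<forall>x\<in>Omega m. f x = (if m = n then x else 0))"
    using graded_map_exists[of "\<lambda>m x. if m = n then x else 0"] by (auto simp: lin_iff)
  from someI_ex[OF this, folded proj_def]
  show "lin (proj n)" "x \<in> Omega m \<Longrightarrow> proj n x = (if m = n then x else 0)" by auto
qed

lemmas proj_add = module_hom.add[OF proj_lin]
  and proj_diff = module_hom.diff[OF proj_lin]
  and proj_zero = module_hom.zero[OF proj_lin]

lemma proj_in_Omega: "proj n x \<in> Omega n"
  by (induction x rule: form_induct) (auto simp: proj_add proj_Omega Omega_add Omega_zero)

lemma proj_raise: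
  assumes "lin f" "\<And>m x. x \<in> Omega m \<Longrightarrow> f x \<in> Omega (Suc m)"
  shows "proj (Suc n) (f x) = f (proj n x)"
  by (rule form_eqI[OF lin_compose[OF proj_lin assms(1)] lin_compose[OF assms(1) proj_lin]])
    (auto simp: proj_Omega assms(2)[THEN proj_Omega] module_hom.zero[OF assms(1)])

lemma proj_lower:
  assumes "lin f" "\<And>m x. x \<in> Omega (Suc m) \<Longrightarrow> f x \<in> Omega m" "\<And>x. x \<in> Omega 0 \<Longrightarrow> f x = 0"
  shows "proj n (f x) = f (proj (Suc n) x)"
proof (rule form_eqI[OF lin_compose[OF proj_lin assms(1)] lin_compose[OF assms(1) proj_lin]])
  fix m x assume "x \<in> Omega m"
  then show "proj n (f x) = f (proj (Suc n) x)"
    by (cases m) (auto simp: proj_Omega proj_Omega[OF assms(2)] assms(3) proj_zero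
        module_hom.zero[OF assms(1)])
qed

lemma Omega_disjoint: "x \<in> Omega m \<Longrightarrow> x \<in> Omega n \<Longrightarrow> m \<noteq> n \<Longrightarrow> x = 0"
  using proj_Omega[of x m m] proj_Omega[of x n m] by simp

lemma scalars_Omega: "x \<in> scalars \<Longrightarrow> x \<in> Omega 0"
  by (auto simp: scalars_def intro: Omega_scale Omega_one)

section \<open>Hochschild, Karoubi and Connes operators\<close>

lemma sign_parity: "even p = even q \<Longrightarrow> (-1 :: 'w) ^ p = (-1) ^ q"
  by (cases "even p") auto

lemma lin_sign: "lin f \<Longrightarrow> f ((-1) ^ k * x) = (-1) ^ k * f x"
  by (cases "even k") (simp_all add: module_hom.neg)

lemma Omega_sign: "x \<in> Omega n \<Longrightarrow> (-1) ^ k * x \<in> Omega n"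
  by (cases "even k") (simp_all add: Omega_neg)

text \<open>Forms of degree zero and the products \<open>\<alpha> * d (j a)\<close> span; this
  yields uniqueness of operators given by a formula on such products.\<close>

lemma form_snoc_eqI:
  assumes "lin f" "lin g" "\<And>x. x \<in> Omega 0 \<Longrightarrow> f x = g x"
    and "\<And>m \<alpha> a. \<alpha> \<in> Omega m \<Longrightarrow> f (\<alpha> * d (j a)) = g (\<alpha> * d (j a))"
  shows "f = g"
proof
  fix x
  show "f x = g x"
  proof (rule form_eqI_basic[OF assms(1,2)])
    fix a as
    show "f (j a * dword as) = g (j a * dword as)"
    proof (cases as rule: rev_cases)
      case Nil
      then show ?thesis using assms(3) Omega_j by simp
    next
      case (snoc bs b)
      then show ?thesis using assms(4)[OF Omega_basic[of a bs], of b] by (simp add: mult.assoc)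
    qed
  qed
qed

lemma normalized_hochschild:
  "normalized_multilinear sA sO (\<lambda>a as. if as = [] then 0 else (-1) ^ (length as - 1) *
     (j a * dword (butlast as) * j (last as) - j (last as) * (j a * dword (butlast as))))"
  (is "normalized_multilinear sA sO ?F")
proof -
  \<comment> \<open>The last argument enters without \<open>d\<close>, through a commutator that
    vanishes at 1; the earlier ones enter through \<open>d\<close>. Hence the case distinction on
    whether \<open>ys\<close> is empty.\<close>
  have *: "module_hom sA sO (\<lambda>a. ?F a0 (xs @ a # ys)) \<and> ?F a0 (xs @ 1 # ys) = 0" for a0 xs ys
    by (cases ys rule: rev_cases)
      (simp_all add: module_hom_iff om.module_axioms alg.module_axioms j_add
      j_scale j_one d_add d_scale d_one algebra_simps om.scale_mult_left[symmetric]
      om.scale_mult_right[symmetric] butlast_append)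
  have "module_hom sA sO (\<lambda>a. ?F a as)" for as
    by (simp add: module_hom_iff om.module_axioms alg.module_axioms j_add
      j_scale algebra_simps om.scale_mult_left[symmetric] om.scale_mult_right[symmetric])
  with * show ?thesis unfolding normalized_multilinear_def by blast
qed

lemma hochschild_unique:
  "\<exists>!f. lin f \<and> (\<forall>x\<in>Omega 0. f x = 0) \<and>
     (\<forall>m. \<forall>\<alpha>\<in>Omega m. \<forall>a. f (\<alpha> * d (j a)) = (-1) ^ m * scomm m 0 \<alpha> (j a))"
proof -
  obtain f where f: "lin f" and f_basic: "\<And>a as. f (j a * dword as) =
      (if as = [] then 0 else (-1) ^ (length as - 1) *
         (j a * dword (butlast as) * j (last as) - j (last as) * (j a * dword (butlast as))))"
    using linear_map_exists[OF om.module_axioms normalized_hochschild] by blast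
  have "f x = 0" if "x \<in> Omega 0" for x
    using f_basic[of _ "[]"] by (intro Omega_eqI[OF f lin_zero _ that]) simp
  moreover have "f (\<alpha> * d (j a)) = (-1) ^ m * scomm m 0 \<alpha> (j a)" if "\<alpha> \<in> Omega m" for m \<alpha> a
  proof (rule Omega_eqI[where f = "\<lambda>\<alpha>. f (\<alpha> * d (j a))" and g = "\<lambda>\<alpha>. (-1) ^ m * scomm m 0 \<alpha> (j a)",
        OF _ _ _ that])
    show "lin (\<lambda>\<alpha>. f (\<alpha> * d (j a)))"
      by (rule lin_compose[OF f lin_mult_right[OF lin_id]])
    show "lin (\<lambda>\<alpha>. (-1) ^ m * scomm m 0 \<alpha> (j a))"
      unfolding scomm_def by (intro lin_intros)
    fix b bs assume "length (bs :: 'a list) = m"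
    then show "f (j b * dword bs * d (j a)) = (-1) ^ m * scomm m 0 (j b * dword bs) (j a)"
      using f_basic[of b "bs @ [a]"] by (simp add: scomm_def mult.assoc)
  qed
  ultimately have f_all: "lin f \<and> (\<forall>x\<in>Omega 0. f x = 0) \<and>
     (\<forall>m. \<forall>\<alpha>\<in>Omega m. \<forall>a. f (\<alpha> * d (j a)) = (-1) ^ m * scomm m 0 \<alpha> (j a))"
    using f by blast
  show ?thesis
  proof (rule ex1I[of _ f], rule f_all)
    fix g assume g: "lin g \<and> (\<forall>x\<in>Omega 0. g x = 0) \<and>
     (\<forall>m. \<forall>\<alpha>\<in>Omega m. \<forall>a. g (\<alpha> * d (j a)) = (-1) ^ m * scomm m 0 \<alpha> (j a))"
    show "g = f"
    proof (rule form_snoc_eqI)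
      show "g (\<alpha> * d (j a)) = f (\<alpha> * d (j a))" if "\<alpha> \<in> Omega m" for m \<alpha> a
        using f_all g that by metis
      show "g x = f x" if "x \<in> Omega 0" for x
        using f_all g that by metis
    qed (use f_all g in blast)+
  qed
qed

lemma hochschild_lin: "lin hochschild"
  and hochschild_Omega_0: "x \<in> Omega 0 \<Longrightarrow> hochschild x = 0"
  and hochschild_snoc:
    "\<alpha> \<in> Omega m \<Longrightarrow> hochschild (\<alpha> * d (j a)) = (-1) ^ m * (\<alpha> * j a - j a * \<alpha>)"
  using theI'[OF hochschild_unique, folded hochschild_def] by (auto simp: scomm_def)

lemmas hochschild_add = module_hom.add[OF hochschild_lin]
  and hochschild_diff = module_hom.diff[OF hochschild_lin]
  and hochschild_scale = module_hom.scale[OF hochschild_lin]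
  and hochschild_zero = module_hom.zero[OF hochschild_lin]
  and hochschild_sum = module_hom.sum[OF hochschild_lin]
  and hochschild_neg = module_hom.neg[OF hochschild_lin]

lemma hochschild_Omega: "x \<in> Omega (Suc n) \<Longrightarrow> hochschild x \<in> Omega n"
proof (induction rule: Omega_induct)
  case (basic a as)
  then obtain bs b where as: "as = bs @ [b]" "length bs = n" by (cases as rule: rev_cases) auto
  have *: "j a * dword bs \<in> Omega n" using Omega_basic as by blast
  have "hochschild (j a * dword as) = hochschild (j a * dword bs * d (j b))"
    by (simp add: as mult.assoc)
  also have "\<dots> \<in> Omega n"
    using Omega_mult[OF * Omega_j, of b] Omega_mult[OF Omega_j *, of b]
    by (simp add: hochschild_snoc[OF *] Omega_sign Omega_diff)
  finally show ?case .
qed (simp_all add: hochschild_zero hochschild_add hochschild_scale Omega_zero Omega_add Omega_scale)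

lemma hochschild_Omega_pred: "x \<in> Omega n \<Longrightarrow> hochschild x \<in> Omega (n - 1)"
  by (cases n) (auto simp: hochschild_Omega hochschild_Omega_0 Omega_zero)

text \<open>On \<beta> db dc, rewriting (\<beta> db) c as \<beta> d(bc) - \<beta> b dc brings every
  term of the first application to the shape required by the second; the resulting terms cancel by
  associativity.\<close>

lemma hochschild_hochschild: "hochschild (hochschild x) = 0"
proof (rule form_eqI_basic[OF lin_compose[OF hochschild_lin hochschild_lin] lin_zero])
  fix a as
  show "hochschild (hochschild (j a * dword as)) = 0"
  proof (cases as rule: rev_cases)
    case Nil
    then show ?thesis using Omega_j by (simp add: hochschild_Omega_0 hochschild_zero)
  next
    case as: (snoc cs c)
    show ?thesis
    proof (cases cs rule: rev_cases)
      case Nil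
      then have "j a * dword as \<in> Omega (Suc 0)" using Omega_basic[of a as] as by simp
      then show ?thesis by (intro hochschild_Omega_0 hochschild_Omega)
    next
      case cs: (snoc bs b)
      define \<beta> where "\<beta> = j a * dword bs"
      define m where "m = length bs"
      have \<beta>: "\<beta> \<in> Omega m" unfolding \<beta>_def m_def by (rule Omega_basic)
      have \<beta>b: "\<beta> * d (j b) \<in> Omega (Suc m)" using Omega_mult[OF \<beta> Omega_dj] by simp
      have 1: "\<beta> * j b \<in> Omega m" using Omega_mult[OF \<beta> Omega_j] by simp
      have 2: "j c * \<beta> \<in> Omega m" using Omega_mult[OF Omega_j \<beta>] by simp
      have "\<beta> * d (j b) * j c = \<beta> * d (j (b * c)) - \<beta> * j b * d (j c)"
        by (simp add: j_mult d_j_mult algebra_simps)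
      then have "hochschild (\<beta> * d (j b) * d (j c)) = (-1) ^ Suc m *
          (\<beta> * d (j (b * c)) - \<beta> * j b * d (j c) - j c * \<beta> * d (j b))"
        by (simp only: hochschild_snoc[OF \<beta>b]) (simp add: mult.assoc)
      then have "hochschild (hochschild (\<beta> * d (j b) * d (j c))) = (-1) ^ Suc m * (-1) ^ m *
          ((\<beta> * j (b * c) - j (b * c) * \<beta>) - (\<beta> * j b * j c - j c * (\<beta> * j b))
           - (j c * \<beta> * j b - j b * (j c * \<beta>)))"
        by (simp only: lin_sign[OF hochschild_lin] hochschild_diff hochschild_snoc[OF \<beta>]
            hochschild_snoc[OF 1] hochschild_snoc[OF 2]) (simp add: algebra_simps)
      also have "\<dots> = 0" by (simp add: j_mult algebra_simps)
      finally show ?thesis by (simp add: as cs \<beta>_def mult.assoc)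
    qed
  qed
qed

text \<open>The Karoubi operator, encoded by the homotopy formula 1 - \<kappa> = bd + db, so that it
  visibly commutes with b and d. In degree zero it is the identity, whereas \<open>karoubi\<close>
  is zero there.\<close>

definition kap :: "'w \<Rightarrow> 'w" where
  "kap x = x - hochschild (d x) - d (hochschild x)"

lemma kap_lin: "lin kap"
  unfolding kap_def
  by (intro lin_diff lin_id lin_compose[OF hochschild_lin d_linear]
      lin_compose[OF d_linear hochschild_lin])

lemmas kap_scale = module_hom.scale[OF kap_lin]
  and kap_sum = module_hom.sum[OF kap_lin]

lemma kap_d: "kap (d x) = d (kap x)"
  by (simp add: kap_def d_d d_diff hochschild_zero)

lemma kap_hochschild: "kap (hochschild x) = hochschild (kap x)"
  by (simp add: kap_def hochschild_hochschild hochschild_diff d_zero)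

lemma kap_pow_d: "(kap ^^ i) (d x) = d ((kap ^^ i) x)"
  by (induction i) (simp_all add: kap_d)

lemma kap_pow_hochschild: "(kap ^^ i) (hochschild x) = hochschild ((kap ^^ i) x)"
  by (induction i) (simp_all add: kap_hochschild)

lemmas kap_pow_lin = lin_funpow[OF kap_lin]

lemma kap_Omega: "x \<in> Omega n \<Longrightarrow> kap x \<in> Omega n"
proof (cases n)
  case 0
  assume "x \<in> Omega n"
  then show ?thesis
    using hochschild_Omega[OF d_Omega[of x n]] 0
    by (simp add: kap_def Omega_diff hochschild_Omega_0 d_zero)
next
  case (Suc m)
  assume "x \<in> Omega n"
  then show ?thesis
    using hochschild_Omega[OF d_Omega[of x n]] d_Omega[OF hochschild_Omega[of x m]] Suc
    by (simp add: kap_def Omega_diff)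
qed

lemma kap_pow_Omega: "x \<in> Omega n \<Longrightarrow> (kap ^^ i) x \<in> Omega n"
  by (induction i) (simp_all add: kap_Omega)

lemma hochschild_d_Omega_0: "x \<in> Omega 0 \<Longrightarrow> hochschild (d x) = 0"
proof (induction rule: Omega_induct)
  case (basic a as)
  then show ?case using hochschild_snoc[OF Omega_one, of a] by simp
qed (simp_all add: d_zero d_add d_scale hochschild_zero hochschild_add hochschild_scale)

lemma kap_Omega_0: "x \<in> Omega 0 \<Longrightarrow> kap x = x"
  by (simp add: kap_def hochschild_d_Omega_0 hochschild_Omega_0 d_zero)

text \<open>In bd(\<alpha> da) and db(\<alpha> da) the terms d\<alpha> a - a d\<alpha> occur with
  opposite signs; what remains is \<alpha> da minus the rotated form.\<close>

lemma kap_snoc: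
  assumes "\<alpha> \<in> Omega m"
  shows "kap (\<alpha> * d (j a)) = (-1) ^ m * (d (j a) * \<alpha>)"
proof -
  have 1: "d (\<alpha> * d (j a)) = d \<alpha> * d (j a)"
    by (simp add: d_mult[OF assms] d_d)
  have 2: "d (\<alpha> * j a - j a * \<alpha>) = d \<alpha> * j a + (-1) ^ m * \<alpha> * d (j a) - d (j a) * \<alpha> - j a * d \<alpha>"
    by (simp add: d_diff d_mult[OF assms] d_j_mult algebra_simps)
  show ?thesis
    unfolding kap_def 1 hochschild_snoc[OF d_Omega[OF assms]] hochschild_snoc[OF assms]
      lin_sign[OF d_linear] 2
    by (cases "even m") (simp_all add: algebra_simps)
qed

text \<open>Each application carries the last differential to the front, with sign (-1) to the total
  degree minus one. The exponent has \<open>+ 1\<close> for \<open>- 1\<close>, which has the same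
  parity and avoids truncated subtraction.\<close>

lemma kap_rotate:
  "\<alpha> \<in> Omega m \<Longrightarrow> (kap ^^ length bs) (\<alpha> * dword bs) =
     (-1) ^ (length bs * (m + length bs + 1)) * (dword bs * \<alpha>)"
proof (induction bs arbitrary: m \<alpha> rule: rev_induct)
  case (snoc b bs)
  let ?i = "length bs"
  have 1: "\<alpha> * dword bs \<in> Omega (m + ?i)" by (rule Omega_mult[OF snoc.prems Omega_dword])
  have 2: "d (j b) * \<alpha> \<in> Omega (Suc m)" using Omega_mult[OF Omega_dj snoc.prems] by simp
  have "(kap ^^ length (bs @ [b])) (\<alpha> * dword (bs @ [b])) =
      (kap ^^ ?i) (kap (\<alpha> * dword bs * d (j b)))"
    by (simp add: funpow_Suc_right mult.assoc del: funpow.simps)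
  also have "\<dots> = (kap ^^ ?i) ((-1) ^ (m + ?i) * (d (j b) * \<alpha> * dword bs))"
    unfolding kap_snoc[OF 1] by (simp add: mult.assoc)
  also have "\<dots> = (-1) ^ (m + ?i) * (kap ^^ ?i) (d (j b) * \<alpha> * dword bs)"
    by (rule lin_sign[OF kap_pow_lin])
  also have "\<dots> = ((-1) ^ (m + ?i + ?i * (Suc m + ?i + 1))) * (dword bs * (d (j b) * \<alpha>))"
    unfolding snoc.IH[OF 2] by (simp only: mult.assoc power_add)
  also have "(-1 :: 'w) ^ (m + ?i + ?i * (Suc m + ?i + 1)) =
      (-1) ^ (length (bs @ [b]) * (m + length (bs @ [b]) + 1))"
    by (rule sign_parity) auto
  finally show ?case by (simp add: mult.assoc)
qed simp

text \<open>On a0 da1 ... dan, n rotations move a0 to the end. The difference from the original form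
  is a commutator with a0, and this is b of da1 ... dan da0 up to the sign produced by
  \<kappa>^n.\<close>

lemma kap_pow_degree:
  assumes "x \<in> Omega n"
  shows "(kap ^^ n) x = x + hochschild ((kap ^^ n) (d x))"
proof (rule Omega_eqI[where f = "\<lambda>x. (kap ^^ n) x" and g = "\<lambda>x. x + hochschild ((kap ^^ n) (d x))", OF _ _ _ assms])
  show "lin (\<lambda>x. (kap ^^ n) x)" by (rule kap_pow_lin)
  show "lin (\<lambda>x. x + hochschild ((kap ^^ n) (d x)))"
    by (intro lin_add lin_id lin_compose[OF hochschild_lin] lin_compose[OF kap_pow_lin] d_linear)
  fix a as assume n: "length (as :: 'a list) = n"
  have 1: "(kap ^^ n) (j a * dword as) = dword as * j a"
    using kap_rotate[OF Omega_j, of as a] n by simp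
  have 2: "(-1 :: 'w) ^ (n * (1 + n + 1)) = (-1) ^ n"
    by (rule sign_parity) auto
  have "(kap ^^ n) (d (j a) * dword as) = (-1) ^ n * (dword as * d (j a))"
    using kap_rotate[OF Omega_dj, of as a] unfolding n 2 .
  moreover have "hochschild (dword as * d (j a)) = (-1) ^ n * (dword as * j a - j a * dword as)"
    using hochschild_snoc[OF Omega_dword] n by simp
  ultimately have "hochschild ((kap ^^ n) (d (j a * dword as))) =
      (-1) ^ n * ((-1) ^ n * (dword as * j a - j a * dword as))"
    by (simp only: d_basic list.map prod_list.Cons lin_sign[OF hochschild_lin])
  then have "hochschild ((kap ^^ n) (d (j a * dword as))) = dword as * j a - j a * dword as"
    by (simp flip: mult.assoc power_add)
  with 1 show "(kap ^^ n) (j a * dword as) = j a * dword as + hochschild ((kap ^^ n) (d (j a * dword as)))"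
    by simp
qed

section \<open>Comparison with the given Karoubi and Connes operators\<close>

lemma karoubi_unique:
  "\<exists>!f. lin f \<and> (\<forall>x\<in>Omega 0. f x = 0) \<and>
     (\<forall>m. \<forall>\<alpha>\<in>Omega m. \<forall>a. f (\<alpha> * d (j a)) = (-1) ^ m * (d (j a) * \<alpha>))"
proof -
  \<comment> \<open>Subtracting the degree zero part corrects \<open>kap\<close> where it is the
    identity and the operator sought is zero.\<close>
  let ?f = "\<lambda>x. kap x - proj 0 x"
  have "lin ?f" by (intro lin_diff kap_lin proj_lin)
  moreover have "?f (\<alpha> * d (j a)) = (-1) ^ m * (d (j a) * \<alpha>)" if "\<alpha> \<in> Omega m" for m \<alpha> a
    using Omega_mult[OF that Omega_dj, of a] by (simp add: kap_snoc[OF that] proj_Omega)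
  ultimately show ?thesis
    by (intro ex1I[of _ ?f]) (auto simp: kap_Omega_0 proj_Omega intro!: form_snoc_eqI)
qed

lemma karoubi_eq:
  assumes "x \<in> Omega (Suc n)"
  shows "karoubi x = kap x"
proof -
  note k = theI'[OF karoubi_unique, folded karoubi_def]
  show ?thesis
  proof (rule Omega_eqI[OF _ kap_lin _ assms])
    show "lin karoubi" using k by blast
    fix a as assume "length (as :: 'a list) = Suc n"
    then obtain bs b where as: "as = bs @ [b]" by (cases as rule: rev_cases) auto
    have "karoubi (j a * dword bs * d (j b)) = kap (j a * dword bs * d (j b))"
      using k kap_snoc[OF Omega_basic] Omega_basic by metis
    then show "karoubi (j a * dword as) = kap (j a * dword as)" by (simp add: as mult.assoc)
  qed
qed

lemma karoubi_pow_eq: "x \<in> Omega (Suc n) \<Longrightarrow> (karoubi ^^ i) x = (kap ^^ i) x"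
  by (induction i) (simp_all add: karoubi_eq[OF kap_pow_Omega])

lemma connes_unique:
  "\<exists>!f. lin f \<and> (\<forall>n. \<forall>x\<in>Omega n. f x = (\<Sum>i\<le>n. (karoubi ^^ i) (d x)))"
proof -
  have "\<exists>f. lin f \<and> (\<forall>n. \<forall>x\<in>Omega n. f x = (\<Sum>i\<le>n. (kap ^^ i) (d x)))"
    by (rule graded_map_exists) (intro lin_sum lin_compose[OF kap_pow_lin] d_linear)
  then obtain f where f: "lin f" and
    f_kap: "\<And>n x. x \<in> Omega n \<Longrightarrow> f x = (\<Sum>i\<le>n. (kap ^^ i) (d x))"
    by blast
  \<comment> \<open>\<open>karoubi\<close> is applied only to forms of the positive degree of
    \<open>d x\<close>, where it agrees with \<open>kap\<close>.\<close>
  have f_eq: "f x = (\<Sum>i\<le>n. (karoubi ^^ i) (d x))" if "x \<in> Omega n" for n x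
    unfolding f_kap[OF that] by (simp only: karoubi_pow_eq[OF d_Omega[OF that]])
  show ?thesis
  proof (rule ex1I[of _ f])
    show "lin f \<and> (\<forall>n. \<forall>x\<in>Omega n. f x = (\<Sum>i\<le>n. (karoubi ^^ i) (d x)))" using f f_eq by blast
    fix g assume g: "lin g \<and> (\<forall>n. \<forall>x\<in>Omega n. g x = (\<Sum>i\<le>n. (karoubi ^^ i) (d x)))"
    show "g = f"
    proof (rule ext, rule form_eqI[of g f])
      fix n x assume "x \<in> Omega n"
      then show "g x = f x" using g f_eq by metis
    qed (use f g in blast)+
  qed
qed

lemma connes_lin: "lin connes"
  and connes_eq: "x \<in> Omega n \<Longrightarrow> connes x = (\<Sum>i\<le>n. (kap ^^ i) (d x))"
proof -
  note c = theI'[OF connes_unique, folded connes_def]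
  then show "lin connes" by blast
  assume x: "x \<in> Omega n"
  then have "connes x = (\<Sum>i\<le>n. (karoubi ^^ i) (d x))" using c by blast
  then show "connes x = (\<Sum>i\<le>n. (kap ^^ i) (d x))"
    by (simp only: karoubi_pow_eq[OF d_Omega[OF x]])
qed

lemmas connes_add = module_hom.add[OF connes_lin]
  and connes_diff = module_hom.diff[OF connes_lin]
  and connes_scale = module_hom.scale[OF connes_lin]
  and connes_zero = module_hom.zero[OF connes_lin]
  and connes_neg = module_hom.neg[OF connes_lin]

lemma connes_Omega: "x \<in> Omega n \<Longrightarrow> connes x \<in> Omega (Suc n)"
  by (simp add: connes_eq Omega_sum kap_pow_Omega d_Omega)

lemma sum_kap_pow_telescope: "(\<Sum>i<n. (kap ^^ i) (x - kap x)) = x - (kap ^^ n) x"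
  by (induction n)
    (simp_all add: module_hom.diff[OF kap_pow_lin] funpow_swap1)

text \<open>On n-forms with n > 0 the sums for Bb and bB have n and n + 1 terms. The first n of each
  add up to the telescoping sum of \<kappa>^i (1 - \<kappa>), that is 1 - \<kappa>^n, and the
  remaining b \<kappa>^n d equals \<kappa>^n - 1 by \<open>kap_pow_degree\<close>.\<close>

lemma connes_hochschild: "connes (hochschild x) = - hochschild (connes x)"
proof -
  have "connes (hochschild x) + hochschild (connes x) = 0"
  proof (rule form_eqI[OF lin_add[OF lin_compose[OF connes_lin hochschild_lin]
          lin_compose[OF hochschild_lin connes_lin]] lin_zero])
    fix n x assume x: "x \<in> Omega n"
    show "connes (hochschild x) + hochschild (connes x) = 0"
    proof (cases n)
      case 0
      then show ?thesis
        using x by (simp add: hochschild_Omega_0 connes_zero connes_eq hochschild_d_Omega_0)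
    next
      case (Suc m)
      have 1: "connes (hochschild x) = (\<Sum>i<n. (kap ^^ i) (d (hochschild x)))"
        using x hochschild_Omega by (simp add: connes_eq Suc lessThan_Suc_atMost)
      have 2: "hochschild (connes x) =
          (\<Sum>i<n. (kap ^^ i) (hochschild (d x))) + hochschild ((kap ^^ n) (d x))"
        using x by (simp add: connes_eq hochschild_sum kap_pow_hochschild hochschild_add
            lessThan_Suc_atMost[symmetric])
      have "x - kap x = d (hochschild x) + hochschild (d x)"
        by (simp add: kap_def)
      then have "(\<Sum>i<n. (kap ^^ i) (d (hochschild x))) + (\<Sum>i<n. (kap ^^ i) (hochschild (d x)))
          = x - (kap ^^ n) x"
        using sum_kap_pow_telescope[of x n]
        by (simp add: module_hom.add[OF kap_pow_lin] sum.distrib)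
      then show ?thesis using kap_pow_degree[OF x] unfolding 1 2 by (simp add: algebra_simps)
    qed
  qed
  then show ?thesis by (simp add: eq_neg_iff_add_eq_0)
qed

lemma kap_pow_fixed: "kap x = x \<Longrightarrow> (kap ^^ i) x = x"
  by (induction i) simp_all

lemma connes_fixed:
  assumes "x \<in> Omega n" "kap (d x) = d x"
  shows "connes x = sO (of_nat (Suc n)) (d x)"
  using om.sum_constant_scale[of "d x" "{..n}"]
  by (simp add: connes_eq[OF assms(1)] kap_pow_fixed[OF assms(2)])

lemma connes_d: "connes (d x) = 0"
  by (rule form_eqI[OF lin_compose[OF connes_lin d_linear] lin_zero])
    (simp add: connes_eq[OF d_Omega] d_d module_hom.zero[OF kap_pow_lin])

lemma connes_in_range_d: "connes x \<in> range d"
proof (induction x rule: form_induct)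
  case (add x y)
  then obtain x' y' where "connes x = d x'" "connes y = d y'" by blast
  then have "connes (x + y) = d (x' + y')" by (simp add: connes_add d_add)
  then show ?case by simp
next
  case (hom n x)
  show ?case
    unfolding connes_eq[OF hom] kap_pow_d module_hom.sum[OF d_linear, symmetric] by (rule rangeI)
qed

section \<open>Contraction and commutators\<close>

text \<open>The l-th commutator comes from n - l rotations: they bring a_l to the last place, and b
  then takes the commutator with it. This is i = bN on basic forms.\<close>

lemma contraction_basic:
  "(\<Sum>i<length as. hochschild ((kap ^^ i) (j a0 * dword as))) =
     (\<Sum>l = 1..length as. (-1) ^ ((l - 1) * (length as - 1) + 1) *
        scomm 0 (length as - 1) (j (as ! (l - 1)))
          (dword (drop l as) * j a0 * dword (take (l - 1) as)))"
proof (rule sum.reindex_bij_witness[of _ "\<lambda>l. length as - l" "\<lambda>i. length as - i"])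
  fix i assume "i \<in> {..<length as}"
  then obtain r where n: "length as = Suc (r + i)"
    using less_iff_Suc_add[of i "length as"] by (auto simp: add.commute)
  \<comment> \<open>With l = n - i, the number \<open>r\<close> is l - 1, the position of a_l
    counted from 0; \<open>xs\<close> and \<open>ys\<close> are the entries before and after
    it.\<close>
  define a xs ys where "a = as ! r" and "xs = take r as" and "ys = drop (Suc r) as"
  have as: "as = xs @ [a] @ ys"
    using id_take_nth_drop[of r as] n unfolding a_def xs_def ys_def by simp
  have len: "length xs = r" "length ys = i"
    using n by (simp_all add: xs_def ys_def)
  have 1: "j a0 * dword (xs @ [a]) \<in> Omega (Suc r)"
    using Omega_basic[of a0 "xs @ [a]"] len by simp
  have 2: "dword ys * j a0 * dword xs \<in> Omega (i + r)"
    using Omega_mult[OF Omega_mult[OF Omega_dword Omega_j] Omega_dword, of ys a0 xs] len by simp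
  have "(kap ^^ i) (j a0 * dword as) =
      (-1) ^ (i * (Suc r + i + 1)) * (dword ys * j a0 * dword xs * d (j a))"
    using kap_rotate[OF 1, of ys] len by (simp add: as mult.assoc)
  then have "hochschild ((kap ^^ i) (j a0 * dword as)) =
      (-1) ^ (i * (Suc r + i + 1) + (i + r)) *
        (dword ys * j a0 * dword xs * j a - j a * (dword ys * j a0 * dword xs))"
    unfolding power_add mult.assoc[of "(-1) ^ (i * (Suc r + i + 1))"]
    by (simp only: lin_sign[OF hochschild_lin] hochschild_snoc[OF 2] power_add)
  also have "(-1 :: 'w) ^ (i * (Suc r + i + 1) + (i + r)) = (-1) ^ (r * (r + i))"
    by (rule sign_parity) auto
  finally have *: "hochschild ((kap ^^ i) (j a0 * dword as)) = (-1) ^ (r * (r + i)) *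
      (dword ys * j a0 * dword xs * j a - j a * (dword ys * j a0 * dword xs))" .
  have "length as - i = Suc r" "length as - 1 = r + i" "length as - i - 1 = r" using n by simp_all
  \<comment> \<open>The extra 1 in the exponent accounts for the order: the commutator from b has
    a_l on the right, the one in the contraction has it on the left.\<close>
  then show "(-1) ^ ((length as - i - 1) * (length as - 1) + 1) *
        scomm 0 (length as - 1) (j (as ! (length as - i - 1)))
          (dword (drop (length as - i) as) * j a0 * dword (take (length as - i - 1) as)) =
      hochschild ((kap ^^ i) (j a0 * dword as))"
    unfolding * by (simp add: scomm_def right_diff_distrib mult.assoc flip: a_def xs_def ys_def)
qed auto

lemma contraction_unique:
  "\<exists>!f. lin f \<and> (\<forall>a0 as. f (j a0 * dword as) =
        (\<Sum>l = 1..length as. (-1) ^ ((l - 1) * (length as - 1) + 1) *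
           scomm 0 (length as - 1) (j (as ! (l - 1)))
             (dword (drop l as) * j a0 * dword (take (l - 1) as))))"
proof -
  have "\<exists>f. lin f \<and> (\<forall>n. \<forall>x\<in>Omega n. f x = (\<Sum>i<n. hochschild ((kap ^^ i) x)))"
    by (rule graded_map_exists) (intro lin_sum lin_compose[OF hochschild_lin] kap_pow_lin)
  then obtain f where f: "lin f"
      "\<And>a as. f (j a * dword as) = (\<Sum>i<length as. hochschild ((kap ^^ i) (j a * dword as)))"
    using Omega_basic by blast
  show ?thesis
    unfolding contraction_basic[symmetric]
  proof (rule ex1I[of _ f])
    fix g assume g: "lin g \<and> (\<forall>a as. g (j a * dword as) =
        (\<Sum>i<length as. hochschild ((kap ^^ i) (j a * dword as))))"
    show "g = f"
      by (rule ext, rule form_eqI_basic[of g f]) (use f g in auto)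
  qed (use f in simp)
qed

lemma contraction_eq:
  assumes "x \<in> Omega n"
  shows "contraction x = (\<Sum>i<n. hochschild ((kap ^^ i) x))"
proof -
  note c = theI'[OF contraction_unique, folded contraction_def]
  show ?thesis
  proof (rule Omega_eqI[OF _ _ _ assms])
    show "lin contraction" using c by blast
    show "lin (\<lambda>x. \<Sum>i<n. hochschild ((kap ^^ i) x))"
      by (intro lin_sum lin_compose[OF hochschild_lin] kap_pow_lin)
    fix a as assume "length (as :: 'a list) = n"
    then show "contraction (j a * dword as) = (\<Sum>i<n. hochschild ((kap ^^ i) (j a * dword as)))"
      using conjunct2[OF c, folded contraction_basic] by blast
  qed
qed

section \<open>The span of the supercommutators\<close>

lemma commutators_subspace: "om.subspace commutators"
  by (simp add: commutators_def)

lemma scomm_in_commutators: "x \<in> Omega p \<Longrightarrow> y \<in> Omega q \<Longrightarrow> scomm p q x y \<in> commutators"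
  unfolding commutators_def by (rule om.span_base) blast

lemma commutators_sign: "x \<in> commutators \<Longrightarrow> (-1) ^ k * x \<in> commutators"
  by (cases "even k") (auto simp: om.subspace_neg[OF commutators_subspace])

lemma form_snoc_commutators:
  assumes "lin f" "\<And>x. x \<in> Omega 0 \<Longrightarrow> f x = 0"
    and "\<And>m \<alpha> a. \<alpha> \<in> Omega m \<Longrightarrow> f (\<alpha> * d (j a)) \<in> commutators"
  shows "f x \<in> commutators"
proof (induction x rule: form_induct)
  case (add x y)
  then show ?case
    by (simp add: module_hom.add[OF assms(1)] om.subspace_add[OF commutators_subspace])
next
  case (hom n x)
  then show ?case
  proof (induction rule: Omega_induct)
    case (basic a as)
    show ?case
    proof (cases as rule: rev_cases)
      case Nil
      then show ?thesis
        using assms(2)[OF Omega_j] by (simp add: om.subspace_0[OF commutators_subspace])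
    next
      case (snoc bs b)
      then show ?thesis using assms(3)[OF Omega_basic[of a bs], of b] by (simp add: mult.assoc)
    qed
  qed (simp_all add: module_hom.zero[OF assms(1)] module_hom.add[OF assms(1)]
      module_hom.scale[OF assms(1)] om.subspace_0[OF commutators_subspace]
      om.subspace_add[OF commutators_subspace] om.subspace_scale[OF commutators_subspace])
qed

lemma hochschild_in_commutators: "hochschild x \<in> commutators"
proof (rule form_snoc_commutators[OF hochschild_lin hochschild_Omega_0])
  fix m \<alpha> a assume "\<alpha> \<in> Omega m"
  then show "hochschild (\<alpha> * d (j a)) \<in> commutators"
    using scomm_in_commutators[OF _ Omega_j, of \<alpha> m a]
    by (simp add: hochschild_snoc scomm_def commutators_sign)
qed

lemma diff_kap_in_commutators: "x - kap x \<in> commutators"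
proof (rule form_snoc_commutators[where f = "\<lambda>x. x - kap x"])
  show "lin (\<lambda>x. x - kap x)" by (intro lin_diff lin_id kap_lin)
  fix m \<alpha> a assume "\<alpha> \<in> Omega m"
  then show "\<alpha> * d (j a) - kap (\<alpha> * d (j a)) \<in> commutators"
    using scomm_in_commutators[OF _ Omega_dj, of \<alpha> m a]
    by (simp add: kap_snoc scomm_def)
qed (simp add: kap_Omega_0)

lemma diff_kap_pow_in_commutators: "x - (kap ^^ i) x \<in> commutators"
proof (induction i)
  case (Suc i)
  have "x - (kap ^^ Suc i) x = (x - (kap ^^ i) x) + ((kap ^^ i) x - kap ((kap ^^ i) x))"
    by simp
  then show ?case
    using Suc diff_kap_in_commutators om.subspace_add[OF commutators_subspace] by metis
qed (simp add: om.subspace_0[OF commutators_subspace])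

text \<open>For generators, [x, a] is b(x da) up to sign, and [x, da] is (1 - \<kappa>)(x da), which
  is bd + db applied to x da. Conversely bx + dby = b(x - dy) + (1 - \<kappa>)y.\<close>

lemma commutators_eq: "commutators = range (\<lambda>(x, y). hochschild x + d (hochschild y))"
  (is "_ = ?Q")
proof
  have "hochschild x + d (hochschild y) =
      hochschild (x - d y) + (y - kap y)" for x y
    by (simp add: kap_def hochschild_diff)
  then show "?Q \<subseteq> commutators"
    using hochschild_in_commutators diff_kap_in_commutators om.subspace_add[OF commutators_subspace]
    by fastforce
  have QI: "hochschild x + d (hochschild y) \<in> ?Q" for x y by force
  have Q: "om.subspace ?Q"
  proof (rule om.subspaceI)
    show "0 \<in> ?Q" using QI[of 0 0] by (simp add: hochschild_zero d_zero)
    fix u v assume "u \<in> ?Q" "v \<in> ?Q"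
    then obtain x y x' y' where "u = hochschild x + d (hochschild y)" "v = hochschild x' + d (hochschild y')"
      by auto
    then show "u + v \<in> ?Q"
      using QI[of "x + x'" "y + y'"] by (simp add: hochschild_add d_add algebra_simps)
  next
    fix c u assume "u \<in> ?Q"
    then obtain x y where "u = hochschild x + d (hochschild y)" by auto
    then show "sO c u \<in> ?Q"
      using QI[of "sO c x" "sO c y"] by (simp add: hochschild_scale d_scale om.scale_right_distrib)
  qed
  have Q_sign: "(-1) ^ k * x \<in> ?Q" if "x \<in> ?Q" for k x
    using that by (cases "even k") (auto intro: om.subspace_neg[OF Q, simplified])
  have Q_j: "scomm p 0 x (j a) \<in> ?Q" if "x \<in> Omega p" for x p a
  proof -
    have "(-1) ^ p * hochschild (x * d (j a)) \<in> ?Q"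
      using Q_sign[OF QI[of "x * d (j a)" 0], of p] by (simp add: hochschild_zero d_zero)
    then show ?thesis using that
      by (simp add: hochschild_snoc scomm_def flip: mult.assoc power_add)
  qed
  have Q_dj: "scomm p 1 x (d (j a)) \<in> ?Q" if "x \<in> Omega p" for x p a
  proof -
    have "scomm p 1 x (d (j a)) = x * d (j a) - kap (x * d (j a))"
      using that by (simp add: kap_snoc scomm_def)
    then show ?thesis
      using QI[of "d (x * d (j a))" "x * d (j a)"] by (simp add: kap_def add.commute)
  qed
  text \<open>\<open>[x, yz] = [xy, z] \<plusminus> [zx, y]\<close> reduces to commutators with generators.\<close>
  have Q_basic: "scomm p (length as) x (j a * dword as) \<in> ?Q" if "x \<in> Omega p" for x p a as
    using that
  proof (induction as arbitrary: x p rule: rev_induct)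
    case Nil
    then show ?case using Q_j by simp
  next
    case (snoc b bs)
    let ?y = "j a * dword bs" and ?m = "length bs"
    have 1: "x * ?y \<in> Omega (p + ?m)" by (rule Omega_mult[OF snoc.prems Omega_basic])
    have 2: "d (j b) * x \<in> Omega (Suc p)" using Omega_mult[OF Omega_dj snoc.prems] by simp
    have "scomm p (Suc ?m) x (?y * d (j b)) =
        scomm (p + ?m) 1 (x * ?y) (d (j b)) + (-1) ^ (p + ?m) * scomm (Suc p) ?m (d (j b) * x) ?y"
      by (cases "even p"; cases "even ?m") (simp_all add: scomm_def algebra_simps)
    also have "\<dots> \<in> ?Q"
      by (intro om.subspace_add[OF Q] Q_dj[OF 1] Q_sign snoc.IH[OF 2])
    finally show ?case by (simp add: mult.assoc)
  qed
  have "scomm p q x y \<in> ?Q" if "x \<in> Omega p" "y \<in> Omega q" for p q x y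
    using that(2)
  proof (induction rule: Omega_induct)
    case (scale c y)
    have "scomm p q x (sO c y) = sO c (scomm p q x y)"
      by (simp add: scomm_def om.scale_right_diff_distrib om.scale_mult_left[symmetric]
          om.scale_mult_right[symmetric])
    then show ?case using om.subspace_scale[OF Q] scale by simp
  next
    case (add y z)
    have "scomm p q x (y + z) = scomm p q x y + scomm p q x z"
      by (simp add: scomm_def algebra_simps)
    then show ?case using om.subspace_add[OF Q] add by simp
  next
    case zero
    show ?case using om.subspace_0[OF Q] by (simp add: scomm_def)
  next
    case (basic a as)
    then show ?case using Q_basic[OF that(1)] by blast
  qed
  then show "commutators \<subseteq> ?Q"
    unfolding commutators_def by (intro om.span_minimal Q) auto
qed

end

section \<open>Isomorphisms of subquotients\<close>

lemma (in module) subspace_set_plus: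
  assumes "subspace S" "subspace T"
  shows "subspace (S + T)"
proof (rule subspaceI)
  show "0 \<in> S + T"
    using set_plus_intro[OF subspace_0[OF assms(1)] subspace_0[OF assms(2)]] by simp
  fix x y assume "x \<in> S + T" "y \<in> S + T"
  then obtain a b a' b' where *: "x = a + b" "y = a' + b'" "a \<in> S" "a' \<in> S" "b \<in> T" "b' \<in> T"
    by (auto elim!: set_plus_elim)
  have "x + y = (a + a') + (b + b')" by (simp add: * algebra_simps)
  also have "\<dots> \<in> S + T" using * assms by (intro set_plus_intro subspace_add)
  finally show "x + y \<in> S + T" .
next
  fix c x assume "x \<in> S + T"
  then obtain a b where *: "x = a + b" "a \<in> S" "b \<in> T" by (auto elim!: set_plus_elim)
  then show "scale c x \<in> S + T"
    using assms by (auto simp: scale_right_distrib intro: subspace_scale)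
qed

lemma (in module) set_plus_subspace_absorb:
  assumes "subspace N"
  shows "N + N = N"
proof
  show "N + N \<subseteq> N" using assms by (auto elim!: set_plus_elim intro: subspace_add)
  show "N \<subseteq> N + N" using subspace_0[OF assms] by (rule set_zero_plus2)
qed

lemma (in module) coset_eq_iff:
  assumes "subspace N"
  shows "x +o N = y +o N \<longleftrightarrow> x - y \<in> N"
proof
  assume "x +o N = y +o N"
  moreover have "x \<in> x +o N" using set_plus_intro2[OF subspace_0[OF assms], of x] by simp
  ultimately have "x \<in> y +o N" by simp
  then show "x - y \<in> N" by (rule set_plus_imp_minus)
next
  assume *: "x - y \<in> N"
  have sub: "a +o N \<subseteq> b +o N" if "a - b \<in> N" for a b
  proof
    fix z assume "z \<in> a +o N"
    then have "z - a \<in> N" by (rule set_plus_imp_minus)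
    then have "(z - a) + (a - b) \<in> N" using that by (rule subspace_add[OF assms])
    then show "z \<in> b +o N" by (intro set_minus_imp_plus) simp
  qed
  have "y - x \<in> N" using subspace_neg[OF assms *] by simp
  with * show "x +o N = y +o N" using sub by blast
qed

lemma (in module) coset_scale_eq:
  assumes "subspace N"
  shows "coset_scale scale (Z, N) c (x +o N) = scale c x +o N"
proof -
  have "scale c ` (x +o N) + N \<subseteq> scale c x +o N"
  proof
    fix z assume "z \<in> scale c ` (x +o N) + N"
    then obtain a b where "z = scale c (x + a) + b" "a \<in> N" "b \<in> N"
      by (auto elim!: set_plus_elim simp: elt_set_plus_def)
    then show "z \<in> scale c x +o N"
      using assms by (auto simp: scale_right_distrib add.assoc elt_set_plus_def
          intro: subspace_add subspace_scale)
  qed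
  moreover have "scale c x +o N \<subseteq> scale c ` (x +o N) + N"
  proof (rule set_plus_mono3, rule imageI)
    show "x \<in> x +o N" using set_plus_intro2[OF subspace_0[OF assms], of x] by simp
  qed
  ultimately show ?thesis by (simp add: coset_scale_def)
qed

text \<open>Applied to differences of representatives, \<open>mem_iff\<close> gives well-definedness
  from right to left and injectivity from left to right; \<open>onto\<close> asks for preimages only
  modulo \<open>N'\<close>.\<close>

lemma induces_isoI:
  assumes f: "module_hom s t f"
    and Z: "module.subspace s Z" and N: "module.subspace s N" and N': "module.subspace t N'"
    and maps: "\<And>x. x \<in> Z \<Longrightarrow> f x \<in> Z'"
    and mem_iff: "\<And>x. x \<in> Z \<Longrightarrow> f x \<in> N' \<longleftrightarrow> x \<in> N"
    and onto: "\<And>y. y \<in> Z' \<Longrightarrow> \<exists>x\<in>Z. f x - y \<in> N'"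
  shows "induces_iso f s (Z, N) t (Z', N')"
proof -
  interpret f: module_hom s t f by (rule f)
  \<comment> \<open>A map on cosets as sets is needed, so its value is read off at a chosen
    representative; \<open>coset_iff\<close> shows that the choice does not matter.\<close>
  define \<phi> where "\<phi> X = f (SOME x. x \<in> Z \<and> X = x +o N) +o N'" for X
  have coset_iff: "f x +o N' = f y +o N' \<longleftrightarrow> x +o N = y +o N" if "x \<in> Z" "y \<in> Z" for x y
    using mem_iff[of "x - y"] f.m1.subspace_diff[OF Z that]
    by (simp add: f.m1.coset_eq_iff[OF N] f.m2.coset_eq_iff[OF N'] f.diff)
  have \<phi>: "\<phi> (x +o N) = f x +o N'" if "x \<in> Z" for x
  proof -
    have "\<exists>y. y \<in> Z \<and> x +o N = y +o N" using that by blast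
    from someI_ex[OF this] show ?thesis unfolding \<phi>_def using coset_iff that by metis
  qed
  have "bij_betw \<phi> (cosets (Z, N)) (cosets (Z', N'))"
  proof (rule bij_betw_imageI)
    show "inj_on \<phi> (cosets (Z, N))"
      by (auto simp: inj_on_def cosets_def \<phi> coset_iff)
    show "\<phi> ` cosets (Z, N) = cosets (Z', N')"
    proof
      show "\<phi> ` cosets (Z, N) \<subseteq> cosets (Z', N')"
        using maps by (auto simp: cosets_def \<phi>)
      show "cosets (Z', N') \<subseteq> \<phi> ` cosets (Z, N)"
      proof
        fix Y assume "Y \<in> cosets (Z', N')"
        then obtain y where y: "y \<in> Z'" "Y = y +o N'" by (auto simp: cosets_def)
        then obtain x where x: "x \<in> Z" "f x - y \<in> N'" using onto by blast
        then have "\<phi> (x +o N) = Y" using y by (simp add: \<phi> f.m2.coset_eq_iff[OF N'])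
        then show "Y \<in> \<phi> ` cosets (Z, N)" using x by (auto simp: cosets_def)
      qed
    qed
  qed
  moreover have "\<phi> (X + Y) = \<phi> X + \<phi> Y" if "X \<in> cosets (Z, N)" "Y \<in> cosets (Z, N)" for X Y
  proof -
    obtain x y where "x \<in> Z" "y \<in> Z" "X = x +o N" "Y = y +o N"
      using \<open>X \<in> _\<close> \<open>Y \<in> _\<close> by (auto simp: cosets_def)
    then show ?thesis
      by (simp add: set_plus_rearrange f.m1.set_plus_subspace_absorb[OF N]
          f.m2.set_plus_subspace_absorb[OF N'] \<phi> f.m1.subspace_add[OF Z] f.add)
  qed
  moreover have "\<phi> (coset_scale s (Z, N) c X) = coset_scale t (Z', N') c (\<phi> X)"
    if "X \<in> cosets (Z, N)" for c X
  proof -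
    obtain x where "x \<in> Z" "X = x +o N"
      using \<open>X \<in> _\<close> by (auto simp: cosets_def)
    then show ?thesis
      by (simp add: f.m1.coset_scale_eq[OF N] f.m2.coset_scale_eq[OF N'] \<phi>
          f.m1.subspace_scale[OF Z] f.scale)
  qed
  ultimately have "quot_iso s (Z, N) t (Z', N') \<phi>"
    unfolding quot_iso_def by blast
  with \<phi> show ?thesis unfolding induces_iso_def by auto
qed

lemma rational_algebra_inverse:
  assumes "rational_algebra TYPE('k::comm_ring_1)"
  shows "\<exists>c :: 'k. c * of_nat (Suc n) = 1"
proof -
  obtain h :: "rat \<Rightarrow> 'k" where h: "h 1 = 1" "\<And>x y. h (x + y) = h x + h y"
    "\<And>x y. h (x * y) = h x * h y"
    using assms unfolding rational_algebra_def unital_ring_hom_def by blast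
  have h_of_nat: "h (of_nat (Suc m)) = of_nat (Suc m)" for m
  proof (induction m)
    case (Suc m)
    have "h (of_nat (Suc (Suc m))) = h (of_nat (Suc m) + 1)" by (simp add: algebra_simps)
    then show ?case using Suc by (simp only: h) (simp add: algebra_simps)
  qed (simp add: h)
  have "h (1 / of_nat (Suc n)) * of_nat (Suc n) = h (1 / of_nat (Suc n) * of_nat (Suc n))"
    unfolding h h_of_nat ..
  also have "\<dots> = 1" using h(1) by (simp del: of_nat_Suc)
  finally show ?thesis by blast
qed

context nc_forms
begin

section \<open>Exactness of the de Rham differential\<close>

lemma scalars_subspace: "om.subspace scalars"
proof (rule om.subspaceI)
  show "0 \<in> scalars" unfolding scalars_def by (rule image_eqI[of _ _ 0]) simp_all
  show "x + y \<in> scalars" if "x \<in> scalars" "y \<in> scalars" for x y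
    using that unfolding scalars_def by (auto simp flip: om.scale_left_distrib)
  show "sO c x \<in> scalars" if "x \<in> scalars" for c x
    using that unfolding scalars_def by auto
qed

lemma scalars_eq_0: "x \<in> scalars \<Longrightarrow> x \<in> Omega (Suc n) \<Longrightarrow> x = 0"
  using Omega_disjoint[OF scalars_Omega] by blast

lemma d_scalars: "x \<in> scalars \<Longrightarrow> d x = 0"
  by (auto simp: scalars_def d_scale d_one)

lemma hochschild_scalars: "x \<in> scalars \<Longrightarrow> hochschild x = 0"
  by (simp add: scalars_Omega hochschild_Omega_0)

text \<open>A retraction \<rho> of the unit gives the homotopy h sending a0 da1 ... dan to
  \<rho>(a0) (a1 - \<rho>(a1)) da2 ... dan. Then 1 - hd - dh is zero in positive degrees and \<rho>
  in degree zero.\<close>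

lemma d_exact:
  assumes "split_unit sA" "d x = 0"
  shows "\<exists>y. x - d y \<in> scalars"
proof -
  obtain \<rho> where \<rho>: "module_hom sA (*) \<rho>" "\<And>c. \<rho> (sA c 1) = c"
    using assms(1) unfolding split_unit_def by blast
  have \<rho>_1: "\<rho> 1 = 1" using \<rho>(2)[of 1] by simp
  note \<rho>_lin = module_hom.add[OF \<rho>(1)] module_hom.scale[OF \<rho>(1)]
  \<comment> \<open>Subtracting \<rho>(b) makes the value vanish at b = 1, as normalization
    requires.\<close>
  let ?F = "\<lambda>a as. case as of [] \<Rightarrow> 0 | b # bs \<Rightarrow> sO (\<rho> a) ((j b - sO (\<rho> b) 1) * dword bs)"
  have norm: "normalized_multilinear sA sO ?F"
  proof -
    have "module_hom sA sO (\<lambda>a. ?F a as)" for as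
      by (cases as) (simp_all add: module_hom_iff om.module_axioms alg.module_axioms \<rho>_lin
          om.scale_left_distrib)
    moreover have "module_hom sA sO (\<lambda>a. ?F a0 (xs @ a # ys))" for a0 xs ys
      by (cases xs) (simp_all add: module_hom_iff om.module_axioms alg.module_axioms \<rho>_lin j_add
          j_scale d_add d_scale algebra_simps om.scale_mult_left[symmetric]
          om.scale_mult_right[symmetric])
    moreover have "?F a0 (xs @ 1 # ys) = 0" for a0 xs ys
      by (cases xs) (simp_all add: \<rho>_1 j_one d_one)
    ultimately show ?thesis unfolding normalized_multilinear_def by blast
  qed
  obtain h where h: "lin h" "\<And>a as. h (j a * dword as) = ?F a as"
    using linear_map_exists[OF om.module_axioms norm] by blast
  have hd: "h (d (j a * dword as)) = (j a - sO (\<rho> a) 1) * dword as" for a as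
    using h(2)[of 1 "a # as"] by (simp only: d_basic) (simp add: j_one \<rho>_1)
  have e: "lin (\<lambda>x. x - h (d x) - d (h x))"
    by (intro lin_diff lin_id lin_compose[OF h(1) d_linear] lin_compose[OF d_linear h(1)])
  have "x - h (d x) - d (h x) \<in> scalars" for x
  proof (induction x rule: form_induct)
    case (add x y)
    then show ?case
      unfolding module_hom.add[OF e] by (rule om.subspace_add[OF scalars_subspace])
  next
    case (hom n x)
    then show ?case
    proof (induction rule: Omega_induct)
      case (add x y)
      from add(3,4) show ?case
        unfolding module_hom.add[OF e] by (rule om.subspace_add[OF scalars_subspace])
    next
      case (scale c x)
      from scale(2) show ?case
        unfolding module_hom.scale[OF e] by (rule om.subspace_scale[OF scalars_subspace])
    next
      case zero
      show ?case
        unfolding module_hom.zero[OF e] by (rule om.subspace_0[OF scalars_subspace])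
    next
      case (basic a as)
      have "j a * dword as - h (d (j a * dword as)) - d (h (j a * dword as)) =
          (if as = [] then sO (\<rho> a) 1 else 0)"
        unfolding hd h(2)
        by (cases as) (simp_all add: d_zero d_scale d_mult[OF Omega_diff[OF Omega_j Omega_scale[OF Omega_one]]]
            d_j_mult d_dword d_diff d_one algebra_simps om.scale_mult_left[symmetric])
      then show ?case using om.subspace_0[OF scalars_subspace] by (simp add: scalars_def)
    qed
  qed
  from this[of x] show ?thesis using assms(2) by (auto simp: module_hom.zero[OF h(1)])
qed

lemma proj_0_d: "proj 0 (d x) = 0"
  by (rule form_eqI[OF lin_compose[OF proj_lin d_linear] lin_zero])
    (simp add: proj_Omega[OF d_Omega])

lemma proj_Suc_d: "proj (Suc n) (d x) = d (proj n x)"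
  by (rule proj_raise[OF d_linear d_Omega])

lemma proj_hochschild: "proj n (hochschild x) = hochschild (proj (Suc n) x)"
  by (rule proj_lower[OF hochschild_lin hochschild_Omega hochschild_Omega_0])

lemma d_exact_0:
  assumes "split_unit sA" "x \<in> Omega 0" "d x = 0"
  shows "x \<in> scalars"
proof -
  obtain y where y: "x - d y \<in> scalars" using d_exact assms by blast
  have "proj 0 (x - d y) = x - d y" using proj_Omega[OF scalars_Omega[OF y]] by simp
  then have "x - d y = x" using proj_Omega[OF assms(2)] by (simp add: proj_diff proj_0_d)
  with y show ?thesis by simp
qed

lemma d_exact_Suc:
  assumes "split_unit sA" "x \<in> Omega (Suc n)" "d x = 0"
  obtains z where "z \<in> Omega n" "x = d z"
proof -
  obtain y where y: "x - d y \<in> scalars" using d_exact assms by blast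
  have "proj (Suc n) (x - d y) = 0" using proj_Omega[OF scalars_Omega[OF y]] by simp
  then have "x = d (proj n y)" using proj_Omega[OF assms(2)] by (simp add: proj_diff proj_Suc_d)
  then show thesis using that proj_in_Omega by blast
qed

section \<open>Reduced Hochschild homology\<close>

text \<open>Because dd = 0, the operator (1 - \<kappa>)d reduces to dbd.\<close>

lemma kap_d_fixed_iff: "kap (d x) = d x \<longleftrightarrow> d (hochschild (d x)) = 0"
  by (simp add: kap_def d_d hochschild_zero)

lemma range_hochschild_subspace: "om.subspace (range hochschild)"
  using hochschild_lin by (metis module_hom.subspace_image om.subspace_UNIV)

lemma range_d_subspace: "om.subspace (range d)"
  using d_linear by (metis module_hom.subspace_image om.subspace_UNIV)

lemma contraction_eq_sum: "x \<in> Omega n \<Longrightarrow> contraction x = (\<Sum>i<n. (kap ^^ i) (hochschild x))"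
  by (simp add: contraction_eq kap_pow_hochschild)

lemma average_commutators:
  assumes "c * of_nat n = 1"
  shows "sO c (\<Sum>i<n. (kap ^^ i) y) - y \<in> commutators"
proof -
  have "y = sO c (sO (of_nat n) y)" using assms by simp
  also have "sO (of_nat n) y = (\<Sum>i<n. y)" using om.sum_constant_scale[of y "{..<n}"] by simp
  finally have "y - sO c (\<Sum>i<n. (kap ^^ i) y) = sO c (\<Sum>i<n. y - (kap ^^ i) y)"
    by (simp add: sum_subtractf om.scale_right_diff_distrib)
  also have "\<dots> \<in> commutators"
    using commutators_subspace diff_kap_pow_in_commutators
    by (auto intro: om.subspace_scale om.subspace_sum)
  finally have "- (y - sO c (\<Sum>i<n. (kap ^^ i) y)) \<in> commutators"
    by (rule om.subspace_neg[OF commutators_subspace])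
  then show ?thesis by simp
qed

lemma hochschild_average:
  "y \<in> Omega n \<Longrightarrow> hochschild (sO c (\<Sum>i<n. (kap ^^ i) y)) = sO c (contraction y)"
  by (simp add: contraction_eq hochschild_scale hochschild_sum)

lemma commutators_in_range_hochschild:
  assumes "rational_algebra TYPE('k)" "x \<in> Omega n" "hochschild x \<in> scalars"
    and "x \<in> commutators + scalars"
  shows "x \<in> range hochschild + scalars"
proof -
  obtain \<beta> \<gamma> s where x: "x = hochschild \<beta> + d (hochschild \<gamma>) + s" and s: "s \<in> scalars"
    using assms(4) by (auto simp: commutators_eq elim!: set_plus_elim)
  show ?thesis
  \<comment> \<open>Projection to degree n removes the exact summand when n = 0 and the scalar when
    n > 0.\<close>
  proof (cases n)
    case 0
    have "x = proj 0 x" using assms(2) 0 by (simp add: proj_Omega)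
    also have "\<dots> = hochschild (proj (Suc 0) \<beta>) + s"
      using proj_Omega[OF scalars_Omega[OF s]] by (simp add: x proj_add proj_0_d proj_hochschild)
    finally show ?thesis using s by blast
  next
    case (Suc m)
    let ?w = "hochschild (proj n \<gamma>)"
    have "x = proj n x" using assms(2) by (simp add: proj_Omega)
    also have "\<dots> = hochschild (proj (Suc n) \<beta>) + d ?w"
      using proj_Omega[OF scalars_Omega[OF s]]
      by (simp add: x Suc proj_add proj_Suc_d proj_hochschild)
    finally have x': "x = hochschild (proj (Suc n) \<beta>) + d ?w" .
    have w: "?w \<in> Omega m" using hochschild_Omega proj_in_Omega Suc by blast
    have "hochschild (d ?w) \<in> scalars"
      using assms(3) by (simp add: x' hochschild_add hochschild_hochschild)
    then have "connes ?w = sO (of_nat (Suc m)) (d ?w)"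
      by (intro connes_fixed[OF w]) (simp add: kap_d_fixed_iff d_scalars)
    moreover obtain c :: 'k where "c * of_nat (Suc m) = 1"
      using rational_algebra_inverse[OF assms(1)] by blast
    ultimately have "d ?w = sO c (connes ?w)" by (simp del: of_nat_Suc)
    \<comment> \<open>Here \<open>connes ?w\<close> is Bb applied to \<open>proj n \<gamma>\<close>;
      as B and b anticommute, \<open>d ?w\<close> is itself a Hochschild boundary.\<close>
    then have "x = hochschild (proj (Suc n) \<beta> - sO c (connes (proj n \<gamma>))) + 0"
      unfolding x' by (simp add: connes_hochschild hochschild_diff hochschild_scale)
    then show ?thesis using om.subspace_0[OF scalars_subspace] by blast
  qed
qed

lemma HH_red_iso:
  assumes "rational_algebra TYPE('k)"
  shows "induces_iso (\<lambda>f. f) sO (HH_red n) sO (ker_DR n)"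
  unfolding HH_red_def homology_def ker_DR_def quot_kernel_def Omega_red_def DR_red_def fst_conv snd_conv
proof (rule induces_isoI)
  show "lin (\<lambda>f. f)" by (rule lin_id)
  show "om.subspace {x \<in> Omega n. hochschild x \<in> scalars}"
    using scalars_subspace by (auto simp: om.subspace_def Omega_zero Omega_add Omega_scale
        hochschild_zero hochschild_add hochschild_scale)
  show "om.subspace (range hochschild + scalars)" "om.subspace (commutators + scalars)"
    using om.subspace_set_plus scalars_subspace range_hochschild_subspace commutators_subspace
    by blast+
next
  fix x assume x: "x \<in> {x \<in> Omega n. hochschild x \<in> scalars}"
  \<comment> \<open>For a cycle of the reduced complex \<open>hochschild x\<close> is only required
    to be a scalar; scalars have degree zero, where \<open>kap\<close> is the identity.\<close>
  then have "(kap ^^ i) (hochschild x) \<in> scalars" for i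
    by (simp add: kap_pow_fixed kap_Omega_0 scalars_Omega)
  moreover have "contraction x = (\<Sum>i<n. (kap ^^ i) (hochschild x))"
    using x contraction_eq_sum by blast
  ultimately show "x \<in> {x \<in> Omega n. contraction x \<in> scalars}"
    using x by (auto intro: om.subspace_sum[OF scalars_subspace])
  show "x \<in> commutators + scalars \<longleftrightarrow> x \<in> range hochschild + scalars"
  proof
    show "x \<in> commutators + scalars \<Longrightarrow> x \<in> range hochschild + scalars"
      using commutators_in_range_hochschild[OF assms] x by blast
    have "range hochschild + scalars \<subseteq> commutators + scalars"
      using hochschild_in_commutators by (intro set_plus_mono2) auto
    then show "x \<in> range hochschild + scalars \<Longrightarrow> x \<in> commutators + scalars" by blast
  qed
next
  fix y assume y: "y \<in> {x \<in> Omega n. contraction x \<in> scalars}"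
  show "\<exists>x\<in>{x \<in> Omega n. hochschild x \<in> scalars}. x - y \<in> commutators + scalars"
  proof (cases n)
    \<comment> \<open>In degree zero there is nothing to average: \<open>y\<close> itself is a
      cycle.\<close>
    case 0
    have "0 \<in> commutators + scalars"
      using om.subspace_set_plus[OF commutators_subspace scalars_subspace] om.subspace_0 by blast
    then show ?thesis using y 0
      by (intro bexI[of _ y]) (auto simp: hochschild_Omega_0 om.subspace_0[OF scalars_subspace])
  next
    case (Suc m)
    obtain c :: 'k where c: "c * of_nat n = 1"
      using rational_algebra_inverse[OF assms] Suc by blast
    let ?x = "sO c (\<Sum>i<n. (kap ^^ i) y)"
    have "?x \<in> Omega n" using y by (simp add: Omega_scale Omega_sum kap_pow_Omega)
    moreover have "hochschild ?x \<in> scalars"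
      using y by (simp add: hochschild_average om.subspace_scale[OF scalars_subspace])
    moreover have "?x - y + 0 \<in> commutators + scalars"
      by (intro set_plus_intro average_commutators[OF c] om.subspace_0[OF scalars_subspace])
    ultimately show ?thesis by auto
  qed
qed

section \<open>Reduced cyclic homology\<close>

lemma lookup_map_0: "f 0 = 0 \<Longrightarrow> Poly_Mapping.lookup (Poly_Mapping.map f p) k = f (Poly_Mapping.lookup p k)"
  by (simp add: Poly_Mapping.map.rep_eq when_def)

lemma lookup_u_mult: "Poly_Mapping.lookup (u_mult f) r = Poly_Mapping.lookup f (Suc r)"
proof -
  have "{r. Poly_Mapping.lookup f (Suc r) \<noteq> 0} = Suc -` Poly_Mapping.keys f"
    by (auto simp: in_keys_iff)
  then have "finite {r. Poly_Mapping.lookup f (Suc r) \<noteq> 0}"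
    by (simp add: finite_vimageI)
  then show ?thesis by (simp add: u_mult_def Abs_poly_mapping_inverse)
qed

lemma lookup_cyclic_diff: "Poly_Mapping.lookup (cyclic_diff f) r =
    hochschild (Poly_Mapping.lookup f r) - connes (Poly_Mapping.lookup f (Suc r))"
  by (simp add: cyclic_diff_def lookup_minus lookup_u_mult lookup_map_0 hochschild_zero connes_zero)

lemma lookup_cyclic_scale: "Poly_Mapping.lookup (cyclic_scale c f) r = sO c (Poly_Mapping.lookup f r)"
  by (simp add: cyclic_scale_def lookup_map_0)

lemma cyclic_module: "module cyclic_scale"
  by unfold_locales
    (auto intro!: poly_mapping_eqI simp: lookup_cyclic_scale lookup_add algebra_simps)

lemma cyclic_diff_hom: "module_hom cyclic_scale cyclic_scale cyclic_diff"
  unfolding module_hom_iff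
  by (auto simp: cyclic_module lookup_cyclic_scale lookup_add lookup_cyclic_diff hochschild_add
      connes_add hochschild_scale connes_scale om.scale_right_diff_distrib intro!: poly_mapping_eqI)

lemma lookup_0_hom: "module_hom cyclic_scale sO (\<lambda>f. Poly_Mapping.lookup f 0)"
  unfolding module_hom_iff
  by (simp add: cyclic_module om.module_axioms lookup_cyclic_scale lookup_add)

text \<open>The element x + u^-1 f. A cyclic chain of degree n + 2 is assembled in this way from its
  lowest coefficient and a chain of degree n.\<close>

definition u_cons :: "'w \<Rightarrow> (nat \<Rightarrow>\<^sub>0 'w) \<Rightarrow> (nat \<Rightarrow>\<^sub>0 'w)" where
  "u_cons x f = Abs_poly_mapping (\<lambda>r. case r of 0 \<Rightarrow> x | Suc r \<Rightarrow> Poly_Mapping.lookup f r)"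

lemma lookup_u_cons:
  "Poly_Mapping.lookup (u_cons x f) r = (case r of 0 \<Rightarrow> x | Suc r \<Rightarrow> Poly_Mapping.lookup f r)"
proof -
  have "{r. (case r of 0 \<Rightarrow> x | Suc r \<Rightarrow> Poly_Mapping.lookup f r) \<noteq> 0} \<subseteq>
      insert 0 (Suc ` Poly_Mapping.keys f)"
  proof
    fix r assume "r \<in> {r. (case r of 0 \<Rightarrow> x | Suc r \<Rightarrow> Poly_Mapping.lookup f r) \<noteq> 0}"
    then show "r \<in> insert 0 (Suc ` Poly_Mapping.keys f)"
      by (cases r) (simp_all add: in_keys_iff)
  qed
  then have "finite {r. (case r of 0 \<Rightarrow> x | Suc r \<Rightarrow> Poly_Mapping.lookup f r) \<noteq> 0}"
    by (rule finite_subset) simp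
  then show ?thesis by (simp add: u_cons_def Abs_poly_mapping_inverse)
qed

lemma lookup_u_cons_simps [simp]:
  "Poly_Mapping.lookup (u_cons x f) 0 = x"
  "Poly_Mapping.lookup (u_cons x f) (Suc r) = Poly_Mapping.lookup f r"
  by (simp_all add: lookup_u_cons)

lemma lookup_single_0: "Poly_Mapping.lookup (Poly_Mapping.single 0 x) r = (if r = 0 then x else 0)"
  for x :: 'w and r :: nat
  by (simp add: lookup_single when_def)

abbreviation cyclic_chain :: "nat \<Rightarrow> (nat \<Rightarrow>\<^sub>0 'w) \<Rightarrow> bool" where
  "cyclic_chain n f \<equiv> \<forall>r. if 2 * r \<le> n then Poly_Mapping.lookup f r \<in> Omega (n - 2 * r)
                 else Poly_Mapping.lookup f r = 0"

abbreviation scalar_chain :: "(nat \<Rightarrow>\<^sub>0 'w) \<Rightarrow> bool" where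
  "scalar_chain f \<equiv> \<forall>r. Poly_Mapping.lookup f r \<in> scalars"

lemma zero_in_scalars: "0 \<in> scalars"
  by (rule om.subspace_0[OF scalars_subspace])

lemma cyclic_chain_nth:
  "cyclic_chain n f \<Longrightarrow> 2 * r \<le> n \<Longrightarrow> Poly_Mapping.lookup f r \<in> Omega (n - 2 * r)"
  "cyclic_chain n f \<Longrightarrow> n < 2 * r \<Longrightarrow> Poly_Mapping.lookup f r = 0"
  by (metis, metis linorder_not_less)

lemma cyclic_chain_0: "cyclic_chain n f \<Longrightarrow> Poly_Mapping.lookup f 0 \<in> Omega n"
  using cyclic_chain_nth(1)[of n f 0] by simp

lemma cyclic_chain_single:
  assumes "x \<in> Omega n"
  shows "cyclic_chain n (Poly_Mapping.single 0 x)"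
  using assms by (simp add: lookup_single_0 Omega_zero)

lemma cyclic_chain_u_cons:
  assumes "x \<in> Omega (Suc (Suc n))" "cyclic_chain n f"
  shows "cyclic_chain (Suc (Suc n)) (u_cons x f)"
proof
  fix r
  show "if 2 * r \<le> Suc (Suc n) then Poly_Mapping.lookup (u_cons x f) r \<in> Omega (Suc (Suc n) - 2 * r)
      else Poly_Mapping.lookup (u_cons x f) r = 0"
    using assms(1) cyclic_chain_nth[OF assms(2), of "r - 1"] by (cases r) auto
qed

section \<open>Lifting and bounding cyclic cycles\<close>

context
  assumes rational: "rational_algebra TYPE('k)" and split: "split_unit sA"
begin

text \<open>The hypothesis makes dx a fixed point of \<kappa>, so Bx is n + 1 times dx and x/(n + 1)
  is a preimage.\<close>

lemma connes_preimage_d: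
  assumes "x \<in> Omega n" "d (hochschild (d x)) = 0"
  obtains y where "y \<in> Omega n" "connes y = d x"
proof -
  obtain c :: 'k where c: "c * of_nat (Suc n) = 1"
    using rational_algebra_inverse[OF rational] by blast
  have "connes x = sO (of_nat (Suc n)) (d x)"
    using assms by (intro connes_fixed) (simp_all add: kap_d_fixed_iff)
  then have "connes (sO c x) = d x" using c by (simp add: connes_scale del: of_nat_Suc)
  then show thesis using that Omega_scale assms(1) by blast
qed

text \<open>Exactness writes by as dz. Since bdz = bby = 0, dz is fixed by \<kappa>, so averaging z
  keeps dz, and division by k + 1 turns d into B. The average moreover satisfies dbz = 0, which
  allows the lift to be repeated.\<close>

lemma connes_lift:
  assumes y: "y \<in> Omega (Suc (Suc k))" and dby: "d (hochschild y) = 0"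
  obtains z where "z \<in> Omega k" "connes z = hochschild y" "d (hochschild z) = 0"
proof -
  obtain z0 where z0: "z0 \<in> Omega k" "hochschild y = d z0"
    using d_exact_Suc[OF split hochschild_Omega[OF y] dby] by blast
  have bdz0: "hochschild (d z0) = 0" by (simp add: hochschild_hochschild flip: z0(2))
  have "\<exists>z1. z1 \<in> Omega k \<and> d z1 = d z0 \<and> d (hochschild z1) = 0"
  proof (cases k)
    case 0
    then show ?thesis using z0 by (auto simp: hochschild_Omega_0 d_zero)
  next
    case (Suc m)
    obtain c :: 'k where c: "c * of_nat k = 1"
      using rational_algebra_inverse[OF rational] Suc by blast
    define z1 where "z1 = sO c (\<Sum>i<k. (kap ^^ i) z0)"
    have kap_dz0: "kap (d z0) = d z0" by (simp add: kap_d_fixed_iff bdz0 d_zero)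
    have "d z1 = sO c (\<Sum>i<k. d z0)"
      by (simp add: z1_def d_scale module_hom.sum[OF d_linear] kap_pow_fixed[OF kap_dz0]
          flip: kap_pow_d)
    also have "\<dots> = d z0"
      using om.sum_constant_scale[of "d z0" "{..<k}"] c by simp
    finally have 1: "d z1 = d z0" .
    \<comment> \<open>The k terms of the average give exactly the terms of \<open>connes\<close> on
      \<open>hochschild z0\<close>, which has degree k - 1. Moving B past b leaves a multiple of
      bdz0, which is zero.\<close>
    have "d (hochschild z1) = sO c (connes (hochschild z0))"
      using hochschild_Omega[of z0 m] z0(1)
      by (simp add: z1_def d_scale module_hom.sum[OF d_linear] hochschild_scale hochschild_sum
          connes_eq Suc lessThan_Suc_atMost kap_pow_d kap_pow_hochschild)
    also have "\<dots> = 0"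
      using z0(1) kap_dz0 bdz0 by (simp add: connes_hochschild connes_fixed hochschild_scale)
    finally show ?thesis
      using 1 z0(1) by (intro exI[of _ z1]) (simp add: z1_def Omega_scale Omega_sum kap_pow_Omega)
  qed
  then obtain z1 where z1: "z1 \<in> Omega k" "d z1 = d z0" "d (hochschild z1) = 0" by blast
  obtain c :: 'k where c: "c * of_nat (Suc k) = 1"
    using rational_algebra_inverse[OF rational] by blast
  have "connes z1 = sO (of_nat (Suc k)) (d z0)"
    using connes_fixed[OF z1(1)] by (simp add: kap_d_fixed_iff z1(2) bdz0 d_zero)
  then have "connes (sO c z1) = hochschild y"
    using c by (simp add: connes_scale z0(2) del: of_nat_Suc)
  moreover have "d (hochschild (sO c z1)) = 0" using z1(3) by (simp add: hochschild_scale d_scale)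
  ultimately show thesis using that Omega_scale[OF z1(1)] by blast
qed

text \<open>Recursion on the degree in steps of two: \<open>connes_lift\<close> supplies the next
  coefficient z with Bz = by, and dbz = 0 is again the hypothesis of the statement.\<close>

lemma cyclic_cycle_extension:
  assumes "y \<in> Omega n" "d (hochschild y) = 0"
  shows "\<exists>f. cyclic_chain n f \<and> scalar_chain (cyclic_diff f) \<and> Poly_Mapping.lookup f 0 = y"
  using assms
proof (induction n arbitrary: y rule: less_induct)
  case (less n)
  show ?case
  proof (cases "n < 2")
    case True
    \<comment> \<open>Here \<open>n - 1\<close> is 0, for n = 0 by truncation. A closed form of
      degree zero is a scalar by exactness, so \<open>y\<close> alone is a cycle.\<close>
    have "hochschild y \<in> Omega 0" using hochschild_Omega_pred[OF less.prems(1)] True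
      by (cases n) (auto simp: less_Suc_eq_0_disj)
    then have "hochschild y \<in> scalars" using d_exact_0[OF split] less.prems(2) by blast
    then have "scalar_chain (cyclic_diff (Poly_Mapping.single 0 y))"
      by (simp add: lookup_cyclic_diff lookup_single_0 hochschild_zero connes_zero zero_in_scalars)
    then show ?thesis
      by (intro exI[of _ "Poly_Mapping.single 0 y"] conjI cyclic_chain_single[OF less.prems(1)])
        simp_all
  next
    case False
    have n: "n = Suc (Suc (n - 2))" using False by simp
    define k where "k = n - 2"
    note n = n[folded k_def]
    obtain z where z: "z \<in> Omega k" "connes z = hochschild y" "d (hochschild z) = 0"
      using connes_lift[of y k] less.prems unfolding n by blast
    then obtain f where f: "cyclic_chain k f" "scalar_chain (cyclic_diff f)" "Poly_Mapping.lookup f 0 = z"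
      using less.IH[of k z] n by auto
    have "Poly_Mapping.lookup (cyclic_diff (u_cons y f)) r \<in> scalars" for r
    proof (cases r)
      case 0
      then show ?thesis by (simp add: lookup_cyclic_diff f(3) z(2) zero_in_scalars)
    next
      case (Suc r')
      then show ?thesis using f(2) by (simp add: lookup_cyclic_diff)
    qed
    moreover have "cyclic_chain n (u_cons y f)"
      using cyclic_chain_u_cons[OF _ f(1)] less.prems(1) unfolding n by blast
    ultimately show ?thesis by (intro exI[of _ "u_cons y f"] conjI allI) simp_all
  qed
qed

text \<open>In positive degree the \<kappa>^i dw sum to zero, so dw is an average of differences dw
  - \<kappa>^i dw and hence equals d(1 - \<kappa>)h. Exactness gives w = (1 - \<kappa>)h + dv =
  b(dh) + d(bh + v), and dbw = 0 puts d(bh + v) in the image of B.\<close>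

lemma connes_kernel:
  assumes w: "w \<in> Omega k" and Bw: "connes w = 0" and dbw: "d (hochschild w) = 0"
  obtains h \<delta> where "\<delta> \<in> Omega (k - 1)" "w - hochschild (d h) - connes \<delta> \<in> scalars"
proof (cases k)
  case 0
  have "d w = 0" using Bw w 0 by (simp add: connes_eq)
  then have "w \<in> scalars" using d_exact_0[OF split] w 0 by blast
  then show thesis
    using that[of 0 0] by (simp add: Omega_zero d_zero hochschild_zero connes_zero)
next
  case (Suc p)
  obtain c :: 'k where c: "c * of_nat (Suc k) = 1"
    using rational_algebra_inverse[OF rational] by blast
  \<comment> \<open>Dividing 1 - \<kappa>^i by 1 - \<kappa> gives the inner sum; the outer sum
    averages over i \<le> k.\<close>
  define h where "h = sO c (\<Sum>i\<le>k. \<Sum>l<i. (kap ^^ l) w)"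
  have h: "h \<in> Omega k"
    using w by (simp add: h_def Omega_scale Omega_sum kap_pow_Omega)
  have tel: "d w - (kap ^^ i) (d w) = (\<Sum>l<i. d ((kap ^^ l) w) - d (kap ((kap ^^ l) w)))" for i
    unfolding sum_kap_pow_telescope[of "d w" i, symmetric]
    by (simp add: module_hom.diff[OF kap_pow_lin] kap_pow_d kap_d funpow_swap1)
  have "(\<Sum>i\<le>k. d w) = sO (of_nat (Suc k)) (d w)"
    using om.sum_constant_scale[of "d w" "{..k}"] by simp
  moreover have "(\<Sum>i\<le>k. d w) = (\<Sum>i\<le>k. d w - (kap ^^ i) (d w))"
    using Bw connes_eq[OF w] by (simp add: sum_subtractf)
  ultimately have "d w = sO c (\<Sum>i\<le>k. d w - (kap ^^ i) (d w))"
    using c by (metis om.scale_one om.scale_scale)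
  also have "\<dots> = sO c (\<Sum>i\<le>k. \<Sum>l<i. d ((kap ^^ l) w) - d (kap ((kap ^^ l) w)))"
    by (simp only: tel)
  also have "\<dots> = d (h - kap h)"
    by (simp add: h_def d_diff d_scale module_hom.sum[OF d_linear] kap_scale kap_sum sum_subtractf
        om.scale_right_diff_distrib)
  finally have "d (w - (h - kap h)) = 0" by (simp add: d_diff)
  then obtain v where v: "v \<in> Omega p" "w - (h - kap h) = d v"
    using d_exact_Suc[OF split, of "w - (h - kap h)" p] w h Suc
    by (auto simp: Omega_diff kap_Omega)
  let ?\<delta> = "hochschild h + v"
  have w_eq: "w = hochschild (d h) + d ?\<delta>"
    using v(2) by (simp add: kap_def d_add algebra_simps)
  have "d (hochschild (d ?\<delta>)) = 0"
    using dbw by (simp add: w_eq hochschild_add hochschild_hochschild)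
  moreover have "?\<delta> \<in> Omega p" using h v(1) Suc by (simp add: hochschild_Omega Omega_add)
  ultimately obtain \<delta> where "\<delta> \<in> Omega p" "connes \<delta> = d ?\<delta>"
    using connes_preimage_d by blast
  then show thesis using that[of \<delta> h] w_eq Suc by (simp add: zero_in_scalars)
qed

text \<open>The lowest coefficient of g is prescribed because the induction uses the statement with
  \<beta> = dh: B kills dh, so correcting the higher coefficients of f leaves the lowest one
  undisturbed.\<close>

lemma cyclic_cycle_boundary:
  assumes "cyclic_chain n f" "scalar_chain (cyclic_diff f)" "\<delta> \<in> Omega (n - 1)"
    and "Poly_Mapping.lookup f 0 - hochschild \<beta> - connes \<delta> \<in> scalars"
  shows "\<exists>g. scalar_chain (f - cyclic_diff g) \<and> Poly_Mapping.lookup g 0 = \<beta>"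
  using assms
proof (induction n arbitrary: f \<beta> \<delta> rule: less_induct)
  case (less n)
  let ?f = "Poly_Mapping.lookup f"
  show ?case
  proof (cases "n < 2")
    case True
    \<comment> \<open>Only the lowest coefficient is present, and b\<delta> = 0 as \<delta> has
      degree zero; so the boundary of \<beta> - \<delta> u^-1 is b\<beta> + B\<delta>.\<close>
    have "?f (Suc r) = 0" for r
      by (rule cyclic_chain_nth(2)[OF less.prems(1)]) (use True in simp)
    moreover have "hochschild \<delta> = 0"
      using less.prems(3) True by (simp add: hochschild_Omega_0 numeral_2_eq_2 less_Suc_eq_0_disj)
    ultimately have "Poly_Mapping.lookup (f - cyclic_diff (u_cons \<beta> (Poly_Mapping.single 0 (- \<delta>)))) r \<in> scalars"
      for r
      using less.prems(4)
      by (cases r) (simp_all add: lookup_minus lookup_cyclic_diff lookup_single_0 hochschild_zero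
          connes_zero hochschild_neg connes_neg zero_in_scalars algebra_simps)
    then show ?thesis
      by (intro exI[of _ "u_cons \<beta> (Poly_Mapping.single 0 (- \<delta>))"]) simp
  next
    case False
    have n: "n = Suc (Suc (n - 2))" using False by simp
    define k where "k = n - 2"
    note n = n[folded k_def]
    \<comment> \<open>Subtracting the boundary of \<beta> - \<delta> u^-1 from f leaves a scalar
      plus u^-1 times \<open>f'\<close>; the added term comes from the part -b\<delta> of that
      boundary.\<close>
    define f' where "f' = u_mult f + Poly_Mapping.single 0 (hochschild \<delta>)"
    have f': "Poly_Mapping.lookup f' r = (if r = 0 then ?f 1 + hochschild \<delta> else ?f (Suc r))" for r
      by (simp add: f'_def lookup_add lookup_u_mult lookup_single_0)
    have "hochschild \<delta> \<in> Omega k" using less.prems(3) n by (simp add: hochschild_Omega)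
    moreover have "?f (Suc 0) \<in> Omega k"
      using cyclic_chain_nth(1)[OF less.prems(1), of 1] by (simp add: n)
    ultimately have chain': "cyclic_chain k f'"
      using cyclic_chain_nth[OF less.prems(1), of "Suc r" for r]
      unfolding f' by (auto simp: n intro!: Omega_add)
    have diff': "Poly_Mapping.lookup (cyclic_diff f') r = Poly_Mapping.lookup (cyclic_diff f) (Suc r)" for r
      by (simp add: lookup_cyclic_diff f' hochschild_add hochschild_hochschild)
    have cycle': "scalar_chain (cyclic_diff f')" unfolding diff' using less.prems(2) by blast
    let ?w = "Poly_Mapping.lookup f' 0"
    define s where "s = ?f 0 - hochschild \<beta> - connes \<delta>"
    have f_0: "?f 0 = hochschild \<beta> + connes \<delta> + s" by (simp add: s_def)
    have f_in: "?f 0 \<in> Omega (Suc (Suc k))" "?f 1 \<in> Omega k"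
      using cyclic_chain_nth(1)[OF less.prems(1), of 0] cyclic_chain_nth(1)[OF less.prems(1), of 1]
      by (simp_all add: n)
    \<comment> \<open>An equality and not merely a congruence, since no nonzero scalar has degree k
      + 1.\<close>
    have "hochschild (?f 0) - connes (?f 1) = 0"
    proof (rule scalars_eq_0)
      show "hochschild (?f 0) - connes (?f 1) \<in> scalars"
        using less.prems(2)[rule_format, of 0] by (simp add: lookup_cyclic_diff)
      show "hochschild (?f 0) - connes (?f 1) \<in> Omega (Suc k)"
        using f_in by (intro Omega_diff hochschild_Omega connes_Omega)
    qed
    then have Bw: "connes ?w = 0"
      using less.prems(4)
      by (simp add: f' f_0 connes_add connes_hochschild hochschild_add hochschild_hochschild
          hochschild_scalars s_def[symmetric])
    \<comment> \<open>The image of B consists of exact forms, so applying d to the cycle condition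
      removes the term with B.\<close>
    obtain t where t: "connes (Poly_Mapping.lookup f' (Suc 0)) = d t"
      using connes_in_range_d by blast
    have "hochschild ?w - d t \<in> scalars"
      using cycle'[rule_format, of 0] by (simp add: lookup_cyclic_diff t)
    then have dbw: "d (hochschild ?w) = 0" using d_scalars[of "hochschild ?w - d t"] by (simp add: d_diff d_d)
    obtain h \<delta>' where \<delta>': "\<delta>' \<in> Omega (k - 1)" "?w - hochschild (d h) - connes \<delta>' \<in> scalars"
      using connes_kernel[OF cyclic_chain_0[OF chain'] Bw dbw] by blast
    then obtain g' where g': "scalar_chain (f' - cyclic_diff g')" "Poly_Mapping.lookup g' 0 = d h"
      using less.IH[of k f' \<delta>' "d h"] chain' cycle' n by auto
    \<comment> \<open>In the lowest coefficient of the boundary the term -\<delta> contributes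
      B\<delta>, while the lowest coefficient dh of \<open>g'\<close> contributes -Bdh = 0.\<close>
    let ?g = "u_cons \<beta> (g' - Poly_Mapping.single 0 \<delta>)"
    have "Poly_Mapping.lookup (f - cyclic_diff ?g) r \<in> scalars" for r
    proof (cases r)
      case 0
      have "Poly_Mapping.lookup (f - cyclic_diff ?g) 0 = s"
        by (simp add: lookup_minus lookup_cyclic_diff lookup_single_0 g'(2) connes_diff connes_d s_def)
      then show ?thesis using 0 less.prems(4) by (simp add: s_def)
    next
      case (Suc r')
      have "Poly_Mapping.lookup (f - cyclic_diff ?g) r = Poly_Mapping.lookup (f' - cyclic_diff g') r'"
        by (simp add: Suc lookup_minus lookup_cyclic_diff lookup_single_0 f' hochschild_diff
            hochschild_zero connes_zero)
      then show ?thesis using g'(1) by simp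
    qed
    then show ?thesis by (intro exI[of _ ?g]) simp
  qed
qed

lemma cyclic_cycle_in_boundaries:
  assumes chain: "cyclic_chain n f" and cycle: "scalar_chain (cyclic_diff f)"
    and mem: "Poly_Mapping.lookup f 0 \<in> commutators + scalars + range d"
  shows "f \<in> range cyclic_diff + Collect scalar_chain"
proof -
  let ?x = "Poly_Mapping.lookup f 0"
  have x: "?x \<in> Omega n" by (rule cyclic_chain_0[OF chain])
  obtain \<beta> \<gamma> s \<epsilon> where "?x = hochschild \<beta> + d (hochschild \<gamma>) + s + d \<epsilon>" and s: "s \<in> scalars"
    using mem by (auto simp: commutators_eq elim!: set_plus_elim)
  then have x_eq: "?x = hochschild \<beta> + d (hochschild \<gamma> + \<epsilon>) + s" by (simp add: d_add)
  \<comment> \<open>The exact summand has to be replaced by some B\<delta> before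
    \<open>cyclic_cycle_boundary\<close> applies; in degree zero it projects to zero.\<close>
  have "\<exists>\<beta> \<delta>. \<delta> \<in> Omega (n - 1) \<and> ?x - hochschild \<beta> - connes \<delta> \<in> scalars"
  proof (cases n)
    case 0
    have "?x = proj 0 ?x" using x 0 by (simp add: proj_Omega)
    also have "\<dots> = hochschild (proj (Suc 0) \<beta>) + s"
      using proj_Omega[OF scalars_Omega[OF s]] by (simp add: x_eq proj_add proj_0_d proj_hochschild)
    finally have "?x - hochschild (proj (Suc 0) \<beta>) - connes 0 \<in> scalars"
      using s by (simp add: connes_zero)
    then show ?thesis using Omega_zero by blast
  next
    case (Suc m)
    let ?\<delta> = "proj m (hochschild \<gamma> + \<epsilon>)"
    have "?x = proj n ?x" using x by (simp add: proj_Omega)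
    also have "\<dots> = hochschild (proj (Suc n) \<beta>) + d ?\<delta>"
      using proj_Omega[OF scalars_Omega[OF s]]
      by (simp add: x_eq Suc proj_add proj_Suc_d proj_hochschild d_add)
    finally have x': "?x = hochschild (proj (Suc n) \<beta>) + d ?\<delta>" .
    obtain t where t: "connes (Poly_Mapping.lookup f (Suc 0)) = d t"
      using connes_in_range_d by blast
    have "hochschild ?x - d t \<in> scalars"
      using cycle[rule_format, of 0] by (simp add: lookup_cyclic_diff t)
    then have "d (hochschild ?x) = 0" using d_scalars[of "hochschild ?x - d t"] by (simp add: d_diff d_d)
    then have "d (hochschild (d ?\<delta>)) = 0" by (simp add: x' hochschild_add hochschild_hochschild)
    then obtain \<delta> where "\<delta> \<in> Omega m" "connes \<delta> = d ?\<delta>"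
      using connes_preimage_d[OF proj_in_Omega] by blast
    then have "\<delta> \<in> Omega (n - 1) \<and> ?x - hochschild (proj (Suc n) \<beta>) - connes \<delta> \<in> scalars"
      using Suc by (simp add: x' zero_in_scalars)
    then show ?thesis by blast
  qed
  then obtain g where "scalar_chain (f - cyclic_diff g)"
    using cyclic_cycle_boundary[OF chain cycle] by blast
  then have "cyclic_diff g + (f - cyclic_diff g) \<in> range cyclic_diff + Collect scalar_chain"
    by (intro set_plus_intro) auto
  then show ?thesis by simp
qed

lemma HC_red_iso:
  "induces_iso (\<lambda>f. Poly_Mapping.lookup f 0) cyclic_scale (HC_red n) sO (ker_DR_mod_d n)"
  unfolding HC_red_def homology_def ker_DR_mod_d_def quot_kernel_def Omega_red_mod_d_def
    DR_red_mod_d_def cyclic_red_def fst_conv snd_conv mem_Collect_eq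
proof (rule induces_isoI)
  interpret cyc: module cyclic_scale by (rule cyclic_module)
  show "module_hom cyclic_scale sO (\<lambda>f. Poly_Mapping.lookup f 0)" by (rule lookup_0_hom)
  have scalar_chains: "cyc.subspace (Collect scalar_chain)"
    using scalars_subspace
    by (auto simp: cyc.subspace_def om.subspace_def lookup_add lookup_cyclic_scale)
  have chains: "cyc.subspace (Collect (cyclic_chain n))"
    by (auto simp: cyc.subspace_def lookup_add lookup_cyclic_scale Omega_zero Omega_add Omega_scale)
  have "cyc.subspace (cyclic_diff -` Collect scalar_chain)"
    using module_hom.subspace_vimage[OF cyclic_diff_hom scalar_chains] .
  from cyc.subspace_inter[OF chains this]
  show "cyc.subspace {f. cyclic_chain n f \<and> scalar_chain (cyclic_diff f)}"
    by (simp add: vimage_def Collect_conj_eq)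
  have "cyc.subspace (range cyclic_diff)"
    using module_hom.subspace_image[OF cyclic_diff_hom cyc.subspace_UNIV] .
  then show "cyc.subspace (range cyclic_diff + Collect scalar_chain)"
    using cyc.subspace_set_plus scalar_chains by blast
  show N': "om.subspace (commutators + scalars + range d)"
    by (intro om.subspace_set_plus commutators_subspace scalars_subspace range_d_subspace)
next
  fix f assume "f \<in> {f. cyclic_chain n f \<and> scalar_chain (cyclic_diff f)}"
  then have f: "cyclic_chain n f" "scalar_chain (cyclic_diff f)" by auto
  let ?x = "Poly_Mapping.lookup f 0" and ?y = "Poly_Mapping.lookup f (Suc 0)"
  have x: "?x \<in> Omega n" by (rule cyclic_chain_0[OF f(1)])
  have sub: "om.subspace (scalars + range d)"
    by (intro om.subspace_set_plus scalars_subspace range_d_subspace)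
  \<comment> \<open>For a cycle, b of the lowest coefficient is a scalar plus an exact form. Powers
    of \<kappa> fix scalars and commute with d, so every term of the contraction has this
    shape.\<close>
  define s where "s = hochschild ?x - connes ?y"
  have s: "s \<in> scalars" using f(2)[rule_format, of 0] by (simp add: s_def lookup_cyclic_diff)
  obtain t where t: "connes ?y = d t" using connes_in_range_d by blast
  have "(kap ^^ i) (hochschild ?x) \<in> scalars + range d" for i
  proof -
    have "(kap ^^ i) (hochschild ?x) = s + d ((kap ^^ i) t)"
      using module_hom.add[OF kap_pow_lin, of i s "connes ?y"] s
      by (simp add: s_def[symmetric] kap_pow_fixed kap_Omega_0 scalars_Omega t kap_pow_d s_def)
    then show ?thesis using s by auto
  qed
  then have "contraction ?x \<in> scalars + range d"
    unfolding contraction_eq_sum[OF x] by (intro om.subspace_sum[OF sub])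
  with x show "?x \<in> {x \<in> Omega n. contraction x \<in> scalars + range d}" by blast
  show "?x \<in> commutators + scalars + range d \<longleftrightarrow> f \<in> range cyclic_diff + Collect scalar_chain"
  proof
    assume "f \<in> range cyclic_diff + Collect scalar_chain"
    then obtain g e where f_eq: "f = cyclic_diff g + e" and e: "scalar_chain e"
      by (auto elim!: set_plus_elim)
    obtain v where v: "connes (Poly_Mapping.lookup g (Suc 0)) = d v" using connes_in_range_d by blast
    have "?x = hochschild (Poly_Mapping.lookup g 0) + Poly_Mapping.lookup e 0 + d (- v)"
      by (simp add: f_eq lookup_add lookup_cyclic_diff v d_neg)
    also have "\<dots> \<in> commutators + scalars + range d"
      using hochschild_in_commutators e by (intro set_plus_intro) auto
    finally show "?x \<in> commutators + scalars + range d" .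
  qed (rule cyclic_cycle_in_boundaries[OF f])
next
  fix y assume "y \<in> {x \<in> Omega n. contraction x \<in> scalars + range d}"
  then have y: "y \<in> Omega n" "contraction y \<in> scalars + range d" by auto
  \<comment> \<open>d kills scalars and exact forms. For the average x of y, dbx is a multiple of
    \<open>d (contraction y)\<close>, which provides the hypothesis of
    \<open>cyclic_cycle_extension\<close>.\<close>
  then have dcy: "d (contraction y) = 0"
    by (auto elim!: set_plus_elim simp: d_add d_scalars d_d)
  have "\<exists>x. x \<in> Omega n \<and> d (hochschild x) = 0 \<and> x - y \<in> commutators"
  proof (cases n)
    case 0
    then show ?thesis using y
      by (intro exI[of _ y]) (simp add: hochschild_Omega_0 d_zero om.subspace_0[OF commutators_subspace])
  next
    case (Suc m)
    obtain c :: 'k where c: "c * of_nat n = 1"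
      using rational_algebra_inverse[OF rational] Suc by blast
    let ?x = "sO c (\<Sum>i<n. (kap ^^ i) y)"
    have "?x \<in> Omega n" using y by (simp add: Omega_scale Omega_sum kap_pow_Omega)
    moreover have "d (hochschild ?x) = 0"
      by (simp add: hochschild_average[OF y(1)] d_scale dcy)
    ultimately show ?thesis using average_commutators[OF c] by blast
  qed
  then obtain x where x: "x \<in> Omega n" "d (hochschild x) = 0" "x - y \<in> commutators" by blast
  obtain f where f: "cyclic_chain n f" "scalar_chain (cyclic_diff f)" "Poly_Mapping.lookup f 0 = x"
    using cyclic_cycle_extension[OF x(1,2)] by blast
  have "x - y + 0 + d 0 \<in> commutators + scalars + range d"
    using x(3) zero_in_scalars by (intro set_plus_intro) auto
  then have "Poly_Mapping.lookup f 0 - y \<in> commutators + scalars + range d"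
    by (simp add: f(3) d_zero)
  then show "\<exists>f\<in>{f. cyclic_chain n f \<and> scalar_chain (cyclic_diff f)}.
      Poly_Mapping.lookup f 0 - y \<in> commutators + scalars + range d"
    using f by blast
qed

end

end

theorem theorem3p1p3:
  fixes sA :: "'k::comm_ring_1 \<Rightarrow> 'a::ring_1 \<Rightarrow> 'a"
    and sO :: "'k \<Rightarrow> 'w::ring_1 \<Rightarrow> 'w"
    and j :: "'a \<Rightarrow> 'w" and d :: "'w \<Rightarrow> 'w"
  assumes "rational_algebra TYPE('k)"
    and "unital_algebra sA"
    and "split_unit sA"
    and "nc_forms sA sO j d"
  shows "(\<forall>n. induces_iso (\<lambda>f. f)
           sO (nc_forms.HH_red sO j d n)
           sO (nc_forms.ker_DR sO j d n)) \<and>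
         (\<forall>n. induces_iso (\<lambda>f. Poly_Mapping.lookup f 0)
           (nc_forms.cyclic_scale sO) (nc_forms.HC_red sO j d n)
           sO (nc_forms.ker_DR_mod_d sO j d n))"
  using nc_forms.HH_red_iso[OF assms(4,1)] nc_forms.HC_red_iso[OF assms(4,1,3)] by blast

end
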